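(* Let $\mathcal{X}$ be a domain, let $\mathcal{H}\subseteq\{0,1\}^{\mathcal{X}}$ be a hypothesis class, and let $\mathrm{VC}(\mathcal{H})=d$. For any $\alpha,\beta\in(0,1)$ and $\epsilon>0$, the algorithm $\mathcal{A}_{\mathsf{SSPP}}$ (described in the context) is an $(\alpha,\beta,\epsilon)$-semi-supervised semi-private agnostic learner for $\mathcal{H}$ with private and public sample complexities $$n_{\mathsf{priv}}=O\left(\bigl(d\log(1/\alpha)+\log(1/\beta)\bigr)\,\max\left(\frac{1}{\alpha^2},\ \frac{1}{\epsilon\,\alpha}\right)\right),\qquad n_{\mathsf{pub}}=O\left(\frac{d\log(1/\alpha)+\log(1/\beta)}{\alpha}\right).$$
   Context: Setting: $\mathcal{X}$ is an arbitrary domain, $\mathcal{Z}=\mathcal{X}\times\{0,1\}$, $\mathcal{D}$ is a distribution over $\mathcal{Z}$, and $\mathcal{D}_{\mathcal{X}}$ is its marginal over $\mathcal{X}$. $\mathrm{VC}(\mathcal{H})$ is the VC dimension of $\mathcal{H}$. The error of $h:\mathcal{X}\to\{0,1\}$ is $\mathrm{err}(h;\mathcal{D})=\Pr_{(x,y)\sim\mathcal{D}}[h(x)\ne y]$; for a labeled dataset $S=((x_1,y_1),\dots,(x_n,y_n))$ the empirical error is $\widehat{\mathrm{err}}(h;S)=\frac1n\sum_{i=1}^n\mathbf{1}(h(x_i)\neq y_i)$. Differential privacy: a randomized algorithm $\mathcal{M}$ on datasets is $\epsilon$-differentially private (pure) if for all pairs of datasets $S,S'$ differing in exactly one data point and every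 measurable set $O$ of outputs, $\Pr[\mathcal{M}(S)\in O]\le e^{\epsilon}\Pr[\mathcal{M}(S')\in O]$. Learner: a randomized algorithm $\mathcal{A}$ is an $(\alpha,\beta,\epsilon)$-semi-supervised semi-private (agnostic) learner for $\mathcal{H}$ with private sample size $n_{\mathsf{priv}}$ and public sample size $n_{\mathsf{pub}}$ if: (1) for every distribution $\mathcal{D}$ over $\mathcal{Z}$, given datasets $S_{\mathsf{priv}}\sim\mathcal{D}^{n_{\mathsf{priv}}}$ (labeled) and $T_{\mathsf{pub}}\sim\mathcal{D}_{\mathcal{X}}^{n_{\mathsf{pub}}}$ (unlabeled), with probability at least $1-\beta$ over the samples and the coins of $\mathcal{A}$, the output $\hat h=\mathcal{A}(S_{\mathsf{priv}},T_{\mathsf{pub}})\in\{0,1\}^{\mathcal{X}}$ satisfies $\mathrm{err}(\hat h;\mathcal{D})\le\inf_{h\in\mathcal{H}}\mathrm{err}(h;\mathcal{D})+\alpha$; and (2) for every $T\in\mathcal{X}^{n_{\mathsf{pub}}}$, the algorithm $\mathcal{A}(\cdot,T)$ is $\epsilon$-differentially private. Algorithm $\mathcal{A}_{\mathsf{SSPP}}$: the input is $S_{\mathsf{priv}}\in\mathcal{Z}^{n_{\mathsf{priv}}}$, $T_{\mathsf{pub}}\in\mathcal{X}^{n_{\mathsf{pub}}}$, $\mathcal{H}$, and $\epsilon>0$. Let $\tilde T=\{\hat x_1,\dots,\hat x_{\hat m}\}$ be the set of points of $\mathcal{X}$ appearing at least once in $T_{\mathsf{pub}}$, and let $\Pi_{\mathcal{H}}(\tilde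 T)=\{(h(\hat x_1),\dots,h(\hat x_{\hat m})):h\in\mathcal{H}\}$. Form the finite class $\widetilde{\mathcal{H}}_{T_{\mathsf{pub}}}\subseteq\mathcal{H}$ by choosing, for each $(c_1,\dots,c_{\hat m})\in\Pi_{\mathcal{H}}(\tilde T)$, one arbitrary $h\in\mathcal{H}$ with $h(\hat x_j)=c_j$ for all $j$ (the class depends only on the public dataset). Then use the exponential mechanism with privacy parameter $\epsilon$ and score $q(S_{\mathsf{priv}},h)=-\widehat{\mathrm{err}}(h;S_{\mathsf{priv}})$ to select the output from $\widetilde{\mathcal{H}}_{T_{\mathsf{pub}}}$, i.e. output $h\in\widetilde{\mathcal{H}}_{T_{\mathsf{pub}}}$ with probability proportional to $\exp\left(-\tfrac{\epsilon\, n_{\mathsf{priv}}}{2}\,\widehat{\mathrm{err}}(h;S_{\mathsf{priv}})\right)$.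
   Formalization: The class is nonempty, its hypotheses are measurable, and the events that it realizes given labels on a finite sample are measurable up to null sets; the constants in O(·) are uniform for α ≤ α₀, for each α₀ < 1, since the bounds fail as α → 1. *)

theory Defs
  imports "HOL-Probability.Probability" "HOL-Library.Landau_Symbols"
begin

text \<open>
  The domain is the space of a measurable space \<open>M\<close>; hypotheses are functions into \<open>bool\<close>, with
  \<open>True\<close> for the label 1, and only their values on \<open>space M\<close> matter. A dataset of size \<open>n\<close> is an
  extensional function on \<open>{..<n}\<close>. Randomized algorithms are functions into \<open>pmf\<close>.
\<close>

section \<open>Hypothesis classes\<close>

definition dichotomies :: "('x \<Rightarrow> bool) set \<Rightarrow> 'x set \<Rightarrow> ('x \<Rightarrow> bool) set" where
  "dichotomies H A = (\<lambda>h. restrict h A) ` H"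

definition shatters :: "('x \<Rightarrow> bool) set \<Rightarrow> 'x set \<Rightarrow> bool" where
  "shatters H A \<longleftrightarrow> dichotomies H A = (A \<rightarrow>\<^sub>E UNIV)"

definition VC :: "'x set \<Rightarrow> ('x \<Rightarrow> bool) set \<Rightarrow> enat" where
  "VC X H = (SUP A\<in>{A. A \<subseteq> X \<and> finite A \<and> shatters H A}. enat (card A))"

text \<open>
  Uniform convergence over a class of finite VC dimension can fail for measurability reasons even
  when every hypothesis is measurable: order \<open>[0,1]\<close> in type \<open>\<omega>\<^sub>1\<close> (continuum hypothesis) and
  take all initial segments together with \<open>[0,1]\<close> itself. The usual remedy is to ask that the
  events decided by the restriction of the class to a finite sample be measurable up to null sets.
\<close>

definition measurable_hypothesis_class :: "'x measure \<Rightarrow> ('x \<Rightarrow> bool) set \<Rightarrow> bool" where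
  "measurable_hypothesis_class M H \<longleftrightarrow>
     (\<forall>h\<in>H. h \<in> measurable M (count_space UNIV)) \<and>
     (\<forall>P (n :: nat) c. prob_space P \<and> sets P = sets M \<longrightarrow>
        {x \<in> {..<n} \<rightarrow>\<^sub>E space M. \<exists>h\<in>H. \<forall>i<n. h (x i) = c i}
          \<in> sets (completion (Pi\<^sub>M {..<n} (\<lambda>_. P))))"

definition err :: "('x \<Rightarrow> bool) \<Rightarrow> ('x \<times> bool) measure \<Rightarrow> real" where
  "err h D = measure D {z \<in> space D. h (fst z) \<noteq> snd z}"

definition emp_err :: "nat \<Rightarrow> ('x \<Rightarrow> bool) \<Rightarrow> (nat \<Rightarrow> 'x \<times> bool) \<Rightarrow> real" where
  "emp_err n h S = (1 / real n) * (\<Sum>i<n. of_bool (h (fst (S i)) \<noteq> snd (S i)))"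

section \<open>Private learning\<close>

definition differentially_private ::
    "'z set \<Rightarrow> nat \<Rightarrow> real \<Rightarrow> ((nat \<Rightarrow> 'z) \<Rightarrow> 'o pmf) \<Rightarrow> bool" where
  "differentially_private Z n \<epsilon> A \<longleftrightarrow>
     (\<forall>S \<in> {..<n} \<rightarrow>\<^sub>E Z. \<forall>S' \<in> {..<n} \<rightarrow>\<^sub>E Z. card {i \<in> {..<n}. S i \<noteq> S' i} = 1 \<longrightarrow>
        (\<forall>U. measure_pmf.prob (A S) U \<le> exp \<epsilon> * measure_pmf.prob (A S') U))"

text \<open>
  The success probability is the integral, over the two independent samples, of the probability of
  success over the coins of the algorithm. For a non-measurable integrand \<open>nn_integral\<close> is the lower
  integral, so the lower bound below is then a statement about inner probability.
\<close>

definition semi_private_learner ::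
    "'x measure \<Rightarrow> ('x \<Rightarrow> bool) set \<Rightarrow> real \<Rightarrow> real \<Rightarrow> real \<Rightarrow> nat \<Rightarrow> nat \<Rightarrow>
     ((nat \<Rightarrow> 'x \<times> bool) \<Rightarrow> (nat \<Rightarrow> 'x) \<Rightarrow> ('x \<Rightarrow> bool) pmf) \<Rightarrow> bool" where
  "semi_private_learner M H \<alpha> \<beta> \<epsilon> n_priv n_pub A \<longleftrightarrow>
     (\<forall>D. prob_space D \<and> sets D = sets (M \<Otimes>\<^sub>M count_space UNIV) \<longrightarrow>
        (\<integral>\<^sup>+ (S, T). ennreal (measure_pmf.prob (A S T)
             {h. err h D \<le> (INF h'\<in>H. err h' D) + \<alpha>})
           \<partial>(Pi\<^sub>M {..<n_priv} (\<lambda>_. D) \<Otimes>\<^sub>M Pi\<^sub>M {..<n_pub} (\<lambda>_. distr D M fst)))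
        \<ge> ennreal (1 - \<beta>)) \<and>
     (\<forall>T \<in> {..<n_pub} \<rightarrow>\<^sub>E space M.
        differentially_private (space M \<times> UNIV) n_priv \<epsilon> (\<lambda>S. A S T))"

section \<open>The algorithm\<close>

text \<open>\<open>\<Delta>\<close> is the sensitivity of the score \<open>q\<close>; \<open>R\<close> is meant to be finite and nonempty.\<close>

definition exponential_mechanism ::
    "real \<Rightarrow> real \<Rightarrow> 'r set \<Rightarrow> ('r \<Rightarrow> real) \<Rightarrow> 'r pmf" where
  "exponential_mechanism \<epsilon> \<Delta> R q =
     embed_pmf (\<lambda>r. if r \<in> R
       then exp (\<epsilon> * q r / (2 * \<Delta>)) / (\<Sum>r'\<in>R. exp (\<epsilon> * q r' / (2 * \<Delta>))) else 0)"

lemma pmf_exponential_mechanism: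
  assumes "finite R" "R \<noteq> {}"
  shows "pmf (exponential_mechanism \<epsilon> \<Delta> R q) r =
     (if r \<in> R then exp (\<epsilon> * q r / (2 * \<Delta>)) / (\<Sum>r'\<in>R. exp (\<epsilon> * q r' / (2 * \<Delta>))) else 0)"
proof -
  let ?w = "\<lambda>r. exp (\<epsilon> * q r / (2 * \<Delta>))"
  let ?f = "\<lambda>r. if r \<in> R then ?w r / sum ?w R else 0"
  have pos: "sum ?w R > 0" using assms by (intro sum_pos) auto
  have nn: "?f r \<ge> 0" for r using pos by simp
  have "(\<integral>\<^sup>+ r. ennreal (?f r) \<partial>count_space UNIV)
      = (\<integral>\<^sup>+ r. ennreal (?w r / sum ?w R) * indicator R r \<partial>count_space UNIV)"
    by (intro nn_integral_cong) (auto simp: indicator_def)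
  also have "\<dots> = (\<Sum>r\<in>R. ennreal (?w r / sum ?w R))"
    using assms by (simp add: nn_integral_count_space_indicator[symmetric] nn_integral_count_space_finite)
  also have "\<dots> = ennreal (\<Sum>r\<in>R. ?w r / sum ?w R)"
    using pos by (intro sum_ennreal) simp
  also have "(\<Sum>r\<in>R. ?w r / sum ?w R) = 1"
    using pos by (simp add: sum_divide_distrib[symmetric])
  finally have one: "(\<integral>\<^sup>+ r. ennreal (?f r) \<partial>count_space UNIV) = 1" by simp
  show ?thesis unfolding exponential_mechanism_def by (rule pmf_embed_pmf[OF nn one])
qed

text \<open>
  A rule for the arbitrary choice of representatives: \<open>rep T c\<close> is the hypothesis chosen, given the
  public dataset \<open>T\<close>, for the dichotomy \<open>c\<close> of the points occurring in \<open>T\<close>.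
\<close>

definition representative_rule ::
    "'x set \<Rightarrow> ('x \<Rightarrow> bool) set \<Rightarrow> nat \<Rightarrow> ((nat \<Rightarrow> 'x) \<Rightarrow> ('x \<Rightarrow> bool) \<Rightarrow> ('x \<Rightarrow> bool)) \<Rightarrow> bool" where
  "representative_rule X H n_pub rep \<longleftrightarrow>
     (\<forall>T \<in> {..<n_pub} \<rightarrow>\<^sub>E X. \<forall>c \<in> dichotomies H (T ` {..<n_pub}).
        rep T c \<in> H \<and> (\<forall>x \<in> T ` {..<n_pub}. rep T c x = c x))"

definition representatives ::
    "('x \<Rightarrow> bool) set \<Rightarrow> ((nat \<Rightarrow> 'x) \<Rightarrow> ('x \<Rightarrow> bool) \<Rightarrow> ('x \<Rightarrow> bool)) \<Rightarrow> nat \<Rightarrow> (nat \<Rightarrow> 'x) \<Rightarrow>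
     ('x \<Rightarrow> bool) set" where
  "representatives H rep n_pub T = rep T ` dichotomies H (T ` {..<n_pub})"

definition A_SSPP ::
    "('x \<Rightarrow> bool) set \<Rightarrow> ((nat \<Rightarrow> 'x) \<Rightarrow> ('x \<Rightarrow> bool) \<Rightarrow> ('x \<Rightarrow> bool)) \<Rightarrow> real \<Rightarrow> nat \<Rightarrow> nat \<Rightarrow>
     (nat \<Rightarrow> 'x \<times> bool) \<Rightarrow> (nat \<Rightarrow> 'x) \<Rightarrow> ('x \<Rightarrow> bool) pmf" where
  "A_SSPP H rep \<epsilon> n_priv n_pub S T =
     exponential_mechanism \<epsilon> (1 / real n_priv) (representatives H rep n_pub T)
       (\<lambda>h. - emp_err n_priv h S)"

lemma finite_representatives: "finite (representatives H rep n_pub T)"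
proof -
  have "dichotomies H (T ` {..<n_pub}) \<subseteq> T ` {..<n_pub} \<rightarrow>\<^sub>E UNIV"
    unfolding dichotomies_def by auto
  then have "finite (dichotomies H (T ` {..<n_pub}))"
    by (rule finite_subset) (auto intro!: finite_PiE)
  then show ?thesis by (simp add: representatives_def)
qed

lemma pmf_A_SSPP:
  assumes "H \<noteq> {}"
  shows "pmf (A_SSPP H rep \<epsilon> n_priv n_pub S T) h =
     (if h \<in> representatives H rep n_pub T
      then exp (- (\<epsilon> * real n_priv / 2) * emp_err n_priv h S) /
        (\<Sum>h' \<in> representatives H rep n_pub T. exp (- (\<epsilon> * real n_priv / 2) * emp_err n_priv h' S))
      else 0)"
proof -
  have "representatives H rep n_pub T \<noteq> {}"
    using assms by (simp add: representatives_def dichotomies_def)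
  then show ?thesis
    unfolding A_SSPP_def
    by (subst pmf_exponential_mechanism[OF finite_representatives]) (simp_all add: mult_ac)
qed

section \<open>Sample complexity\<close>

text \<open>
  The parameters \<open>(d, \<alpha>, \<beta>, \<epsilon>)\<close> over which a bound \<open>O(\<dots>)\<close> is uniform. The accuracy is kept
  bounded away from 1, since the terms with \<open>log (1/\<alpha>)\<close> vanish as \<open>\<alpha> \<rightarrow> 1\<close> while \<open>d\<close> public
  examples may be needed for every \<open>\<alpha> < 1\<close>: on \<open>[0,1]\<close> with uniform marginal and all labels 0, let
  the class consist of the constant 0 and the complements of all sets of \<open>d - 1\<close> points.
\<close>

definition parameters_below :: "real \<Rightarrow> (nat \<times> real \<times> real \<times> real) filter" where
  "parameters_below \<alpha>\<^sub>0 =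
     principal {(d, \<alpha>, \<beta>, \<epsilon>). 0 < \<alpha> \<and> \<alpha> \<le> \<alpha>\<^sub>0 \<and> 0 < \<beta> \<and> \<beta> < 1 \<and> 0 < \<epsilon>}"

end

theory Submission
  imports Defs
begin

text \<open>
  If the public sample is an \<open>\<epsilon>\<close>-net for the disagreement regions \<open>{x. h x \<noteq> h' x}\<close>, then a near-optimal
  hypothesis has a representative of almost the same error; if empirical errors on the private
  sample are uniformly close to true errors, then the exponential mechanism over the few
  representatives finds a near-optimal one. Both conditions fail with small probability by
  symmetrization: the sample is doubled, the halves are randomly swapped pointwise, and the
  expectation over the swaps of a product weight is bounded for each of the traces of the class,
  whose number is controlled by the Sauer--Shelah lemma.
\<close>

section \<open>Counting dichotomies\<close>

text \<open>The public sample carries no labels, so it can only control pairwise disagreement;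
  \<open>err_triangle\<close> converts this into a comparison of errors. Two rates are wanted from
  one argument, \<open>1 / \<alpha>\<close> for the net and \<open>1 / \<alpha>^2\<close> for the
  deviations. Hence \<open>symmetrization\<close> takes an arbitrary pair weight with
  \<open>\<phi> a b + \<phi> b a \<le> 2 * \<kappa>\<close>: its product over the pairs has average
  at most \<open>\<kappa> ^ n\<close> over the swaps, so \<open>\<phi>\<close> acts like a moment
  generating function and each rate is one choice of \<open>\<phi>\<close>. Counting traces by
  \<open>(1 / t) ^ d * exp (t * m)\<close>, with \<open>t\<close> a small multiple of the rate,
  avoids any logarithm of the sample size: the second factor uses up only part of the exponential
  gain, and the rest has to beat \<open>d * ln (1 / t)\<close>, which is the origin of
  \<open>d * ln (1 / \<alpha>)\<close>. The bad events quantify over a possibly uncountable class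
  and need not be measurable; the deviation lemmas therefore deliver a measurable set of good
  samples, and the final integral is bounded below on a product of two such sets.\<close>

lemma shatters_iff: "shatters H B \<longleftrightarrow> (\<forall>c. \<exists>h\<in>H. \<forall>y\<in>B. h y = c y)"
proof
  assume *: "shatters H B"
  show "\<forall>c. \<exists>h\<in>H. \<forall>y\<in>B. h y = c y"
  proof
    fix c
    have "restrict c B \<in> dichotomies H B"
      using * unfolding shatters_def by auto
    then obtain h where "h \<in> H" "restrict c B = restrict h B"
      unfolding dichotomies_def by auto
    then show "\<exists>h\<in>H. \<forall>y\<in>B. h y = c y" by (metis restrict_apply')
  qed
next
  assume *: "\<forall>c. \<exists>h\<in>H. \<forall>y\<in>B. h y = c y"
  have "B \<rightarrow>\<^sub>E UNIV \<subseteq> dichotomies H B"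
  proof
    fix c :: "'a \<Rightarrow> bool" assume c: "c \<in> B \<rightarrow>\<^sub>E UNIV"
    obtain h where h: "h \<in> H" "\<forall>y\<in>B. h y = c y" using * by blast
    then have "c = restrict h B"
      using c by (auto simp: fun_eq_iff PiE_def extensional_def restrict_def)
    then show "c \<in> dichotomies H B" using h by (auto simp: dichotomies_def)
  qed
  then show "shatters H B" by (auto simp: shatters_def dichotomies_def)
qed

lemma finite_dichotomies:
  assumes "finite A"
  shows "finite (dichotomies H A)"
  by (rule finite_subset[of _ "A \<rightarrow>\<^sub>E UNIV"]) (use assms in \<open>auto simp: dichotomies_def intro!: finite_PiE\<close>)

text \<open>Pajor's form of the Sauer--Shelah lemma.\<close>

lemma card_dichotomies_le_card_shattered:
  assumes "finite A"
  shows "card (dichotomies H A) \<le> card {B. B \<subseteq> A \<and> shatters H B}"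
  using assms
proof (induction A arbitrary: H)
  case empty
  have "dichotomies H {} \<subseteq> {\<lambda>_. undefined}" by (auto simp: dichotomies_def)
  show ?case
  proof (cases "H = {}")
    case False
    then have "{B. B \<subseteq> {} \<and> shatters H B} = {{}}" by (auto simp: shatters_iff)
    then show ?thesis using card_mono[OF _ \<open>dichotomies H {} \<subseteq> _\<close>] by simp
  qed (simp add: dichotomies_def)
next
  case (insert x A)
  \<comment> \<open>The class is split by its value at the new point. Within one part that value is
    constant, so dichotomies of \<open>insert x A\<close> are no more numerous than those of
    \<open>A\<close>, and the induction hypothesis applies to each part.\<close>
  define F where "F b = {h\<in>H. h x = b}" for b
  define Sh where "Sh b = {B. B \<subseteq> A \<and> shatters (F b) B}" for b
  have fin: "finite (Sh b)" for b unfolding Sh_def using insert(1) by auto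
  have dich: "dichotomies (F b) (insert x A) = (\<lambda>c. c(x := b)) ` dichotomies (F b) A" for b
    by (auto simp: dichotomies_def F_def image_image restrict_def fun_eq_iff intro!: image_cong)
  have findich: "finite (dichotomies (F b) A)" for b using insert(1) by (rule finite_dichotomies)
  have le: "card (dichotomies (F b) (insert x A)) \<le> card (Sh b)" for b
    using card_image_le[OF findich, of "\<lambda>c. c(x := b)" b] insert.IH[of "F b"]
    unfolding dich Sh_def by linarith
  have H: "dichotomies H (insert x A) = dichotomies (F True) (insert x A) \<union> dichotomies (F False) (insert x A)"
    by (auto simp: dichotomies_def F_def)
  have sh: "Sh True \<union> Sh False \<subseteq> {B. B \<subseteq> A \<and> shatters H B}"
    unfolding Sh_def shatters_iff F_def by blast
  \<comment> \<open>A set shattered by both parts stays shattered when \<open>x\<close> is added,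
    since the label of \<open>x\<close> selects the part. These sets contain \<open>x\<close>, so
    they are new compared with those in \<open>sh\<close>, and they pay for the overlap of the two
    families.\<close>
  have sh2: "insert x ` (Sh True \<inter> Sh False) \<subseteq> {B. B \<subseteq> insert x A \<and> x \<in> B \<and> shatters H B}"
  proof clarify
    fix B assume B: "B \<in> Sh True" "B \<in> Sh False"
    have "\<exists>h\<in>H. \<forall>y\<in>insert x B. h y = c y" for c
    proof -
      have "shatters (F (c x)) B" using B by (cases "c x") (auto simp: Sh_def)
      then obtain h where "h \<in> F (c x)" "\<forall>y\<in>B. h y = c y" unfolding shatters_iff by blast
      then show ?thesis by (auto simp: F_def)
    qed
    then have "shatters H (insert x B)" by (simp add: shatters_iff)
    then show "insert x B \<subseteq> insert x A \<and> x \<in> insert x B \<and> shatters H (insert x B)"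
      using B by (auto simp: Sh_def)
  qed
  have inj: "inj_on (insert x) (Sh True \<inter> Sh False)"
    by (rule inj_onI) (use insert(2) in \<open>auto simp: Sh_def\<close>)
  have "card (dichotomies H (insert x A)) \<le> card (Sh True) + card (Sh False)"
    unfolding H using card_Un_le le[of True] le[of False] by (meson add_mono order_trans)
  also have "\<dots> = card (Sh True \<union> Sh False) + card (insert x ` (Sh True \<inter> Sh False))"
    using card_Un_Int[OF fin fin] by (simp add: card_image[OF inj])
  also have "\<dots> \<le> card {B. B \<subseteq> A \<and> shatters H B} + card {B. B \<subseteq> insert x A \<and> x \<in> B \<and> shatters H B}"
    using insert(1) by (intro add_mono card_mono sh sh2) auto
  also have "\<dots> = card ({B. B \<subseteq> A \<and> shatters H B} \<union> {B. B \<subseteq> insert x A \<and> x \<in> B \<and> shatters H B})"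
    using insert(1,2) by (intro card_Un_disjoint[symmetric]) auto
  also have "\<dots> \<le> card {B. B \<subseteq> insert x A \<and> shatters H B}"
    using insert(1) by (intro card_mono) auto
  finally show ?case .
qed

text \<open>
  The parameter \<open>t\<close> is left free: with \<open>t\<close> proportional to the rate in the exponent of a deviation
  bound, the factor \<open>exp (t * card A)\<close> is absorbed by that bound.
\<close>

lemma card_dichotomies_le:
  fixes t :: real
  assumes "VC X H = enat d" "finite A" "A \<subseteq> X" "0 < t" "t \<le> 1"
  shows "real (card (dichotomies H A)) \<le> (1 / t) ^ d * exp (t * card A)"
proof -
  have card_le: "card B \<le> d" if "B \<subseteq> A" "shatters H B" for B
  proof -
    have "enat (card B) \<le> VC X H"
      unfolding VC_def using that assms(2,3) by (intro SUP_upper) (auto dest: finite_subset)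
    then show ?thesis using assms(1) by simp
  qed
  \<comment> \<open>Every shattered set has at most \<open>d\<close> elements and
    \<open>t \<le> 1\<close>, so its weight \<open>t ^ card B\<close> is at least
    \<open>t ^ d\<close>. The total weight of all subsets is
    \<open>(1 + t) ^ card A\<close>.\<close>
  have "real (card (dichotomies H A)) * t ^ d \<le> (\<Sum>B | B \<subseteq> A \<and> shatters H B. t ^ d)"
    using card_dichotomies_le_card_shattered[OF assms(2), of H] assms(4) by simp
  also have "\<dots> \<le> (\<Sum>B | B \<subseteq> A \<and> shatters H B. t ^ card B)"
    using card_le assms(4,5) by (intro sum_mono power_decreasing) auto
  also have "\<dots> \<le> (\<Sum>B\<in>Pow A. t ^ card B)"
    using assms(2,4) by (intro sum_mono2) auto
  also have "\<dots> = (\<Prod>i\<in>A. t + 1)"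
    using assms(2) by (subst prod_add) auto
  also have "\<dots> \<le> (exp t) ^ card A"
    using assms(4) exp_ge_add_one_self[of t] by (auto intro!: power_mono simp: add.commute)
  also have "\<dots> = exp (t * card A)"
    by (simp add: exp_of_nat_mult[symmetric] mult.commute)
  finally show ?thesis using assms(4) by (simp add: field_simps)
qed

section \<open>Symmetrization\<close>

text \<open>The product \<open>(1 + t + t^2/2) * (1 - t + t^2/2)\<close> equals
  \<open>1 + t^4/4\<close>, so the quadratic lower bound for \<open>exp t\<close> turns into an
  upper bound for its reciprocal.\<close>

lemma exp_minus_le_quadratic:
  assumes "0 \<le> (t::real)"
  shows "exp (- t) \<le> 1 - t + t\<^sup>2 / 2"
proof -
  have pos: "1 - t + t\<^sup>2 / 2 > 0"
  proof -
    have "0 < ((1 - t)\<^sup>2 + 1) / 2" by (simp add: add_nonneg_pos)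
    also have "\<dots> = 1 - t + t\<^sup>2 / 2" unfolding power2_eq_square by (simp add: field_simps)
    finally show ?thesis .
  qed
  have "1 \<le> 1 + (t\<^sup>2)\<^sup>2 / 4" by simp
  also have "\<dots> = (1 + t + t\<^sup>2 / 2) * (1 - t + t\<^sup>2 / 2)"
    by (simp add: power2_eq_square algebra_simps)
  also have "\<dots> \<le> exp t * (1 - t + t\<^sup>2 / 2)"
    using exp_lower_Taylor_quadratic[OF assms] pos by (intro mult_right_mono) auto
  finally show ?thesis by (simp add: exp_minus field_simps)
qed

text \<open>The denominator contains the mean \<open>card J * prob E\<close>, not just
  \<open>card J\<close>. This sharpness for rare events is what allows a net from order
  \<open>1 / \<alpha>\<close> points.\<close>

lemma (in prob_space) chernoff_lower_tail:
  fixes s :: real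
  assumes "finite J" "J \<noteq> {}" "E \<in> events" "prob E > 0" "s \<ge> 0"
  defines "P \<equiv> PiM J (\<lambda>_. M)"
  shows "measure P {y \<in> space P. (\<Sum>j\<in>J. indicator E (y j)) < card J * prob E - s}
    \<le> exp (- (s\<^sup>2 / (2 * card J * prob E)))"
proof -
  interpret PP: product_prob_space "\<lambda>_. M" J by standard
  interpret P: prob_space P unfolding P_def by (rule prob_space_PiM) (rule prob_space_axioms)
  note [measurable] = assms(3)
  define m where "m = real (card J)"
  define p where "p = prob E"
  have m: "m > 0" using assms(1,2) by (simp add: m_def card_gt_0_iff)
  have p: "p > 0" using assms(4) by (simp add: p_def)
  \<comment> \<open>This minimizes \<open>t^2 * m * p / 2 - t * s\<close>, the exponent left after
    Markov's inequality and the quadratic bound.\<close>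
  define t where "t = s / (m * p)"
  have t: "t \<ge> 0" using assms(5) m p by (simp add: t_def)
  define X where "X y = (\<Sum>j\<in>J. indicator E (y j) :: real)" for y
  have exp_ind: "exp (- t * indicator E x) = 1 - (1 - exp (-t)) * indicator E x" for x
    by (simp add: indicator_def)
  have intE: "integrable M (\<lambda>x. exp (- t * indicator E x))"
    unfolding exp_ind
    by (intro Bochner_Integration.integrable_diff integrable_const integrable_mult_right
        integrable_real_indicator assms(3)) (simp add: emeasure_eq_measure)
  have int1: "(\<integral>x. exp (- t * indicator E x) \<partial>M) = 1 - (1 - exp (-t)) * p"
    unfolding exp_ind using assms(3)
    by (subst Bochner_Integration.integral_diff)
       (auto intro!: integrable_mult_right integrable_real_indicator simp: p_def prob_space emeasure_eq_measure)
  have prod: "(\<Prod>j\<in>J. exp (- t * indicator E (y j))) = exp (- t * X y)" for y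
    using assms(1) by (simp add: X_def exp_sum sum_distrib_left)
  have int: "integrable P (\<lambda>y. exp (- t * X y))"
    unfolding P_def prod[symmetric] using assms(1) intE by (intro PP.product_integrable_prod) auto
  have [measurable]: "X \<in> borel_measurable P" unfolding X_def P_def using assms(1) by measurable
  have "measure P {y \<in> space P. X y < m * p - s} = (\<integral>y. indicator {y \<in> space P. X y < m * p - s} y \<partial>P)"
    by simp
  also have "\<dots> \<le> (\<integral>y. exp (t * (m * p - s)) * exp (- t * X y) \<partial>P)"
  proof (intro integral_mono)
    show "integrable P (\<lambda>y. exp (t * (m * p - s)) * exp (- t * X y))" using int by simp
    fix y assume "y \<in> space P"
    show "indicator {y \<in> space P. X y < m * p - s} y \<le> exp (t * (m * p - s)) * exp (- t * X y)"
    proof (cases "X y < m * p - s")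
      case True
      then have "0 \<le> t * ((m * p - s) - X y)" using t by simp
      then have "1 \<le> exp (t * ((m * p - s) - X y))" by simp
      then show ?thesis by (simp add: indicator_def exp_add[symmetric] algebra_simps)
    qed (simp add: indicator_def)
  qed (intro integrable_real_indicator, auto simp: P.emeasure_eq_measure)
  also have "\<dots> = exp (t * (m * p - s)) * (1 - (1 - exp (-t)) * p) ^ card J"
    unfolding prod[symmetric] integral_mult_right_zero
    unfolding P_def using assms(1) intE by (subst PP.product_integral_prod) (auto simp: int1[unfolded mult_minus_left])
  also have "\<dots> \<le> exp (t * (m * p - s)) * exp (- ((t - t\<^sup>2 / 2) * p * m))"
  proof (intro mult_left_mono)
    have "(1 - exp (-t)) * p \<le> 1 * 1"
      using t p by (intro mult_mono) (auto simp: p_def)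
    have "1 - (1 - exp (-t)) * p \<le> exp (- ((1 - exp (-t)) * p))"
      using exp_ge_add_one_self[of "- ((1 - exp (-t)) * p)"] by simp
    also have "\<dots> \<le> exp (- ((t - t\<^sup>2 / 2) * p))"
    proof -
      have "(t - t\<^sup>2 / 2) * p \<le> (1 - exp (-t)) * p"
        using exp_minus_le_quadratic[OF t] p by (intro mult_right_mono) auto
      then show ?thesis by simp
    qed
    finally have "(1 - (1 - exp (-t)) * p) ^ card J \<le> exp (- ((t - t\<^sup>2 / 2) * p)) ^ card J"
      using \<open>(1 - exp (-t)) * p \<le> 1 * 1\<close> by (intro power_mono) auto
    also have "\<dots> = exp (- ((t - t\<^sup>2 / 2) * p * m))"
      by (simp add: exp_of_nat_mult[symmetric] m_def mult_ac)
    finally show "(1 - (1 - exp (-t)) * p) ^ card J \<le> exp (- ((t - t\<^sup>2 / 2) * p * m))" .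
  qed auto
  also have "\<dots> = exp (- (s\<^sup>2 / (2 * m * p)))"
    unfolding exp_add[symmetric] t_def using m p by (simp add: field_simps power2_eq_square)
  finally show ?thesis by (simp add: X_def m_def p_def)
qed

section \<open>Traces and swaps of a doubled sample\<close>

text \<open>Indexed by sample positions, not by points: repetitions are harmless, and a swapped
  sample is described by the same traces read at permuted positions, so one finite set serves all
  swaps.\<close>

definition traces :: "('z \<Rightarrow> bool) set \<Rightarrow> nat \<Rightarrow> (nat \<Rightarrow> 'z) \<Rightarrow> (nat \<Rightarrow> bool) set" where
  "traces G m z = (\<lambda>g. \<lambda>i\<in>{..<m}. g (z i)) ` G"

lemma traces_subset: "traces G m z \<subseteq> {..<m} \<rightarrow>\<^sub>E UNIV"
  by (auto simp: traces_def)

lemma finite_traces: "finite (traces G m z)"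
  by (rule finite_subset[OF traces_subset]) (auto intro!: finite_PiE)

text \<open>An index permutation that exchanges \<open>i\<close> and \<open>i + n\<close> for
  \<open>i\<close> in \<open>\<sigma>\<close>. Acting on indices makes invariance of the product
  measure a mere reindexing.\<close>

definition swap_halves :: "nat \<Rightarrow> nat set \<Rightarrow> nat \<Rightarrow> nat" where
  "swap_halves n \<sigma> i = (if i \<in> \<sigma> then i + n else if n \<le> i \<and> i - n \<in> \<sigma> then i - n else i)"

lemma swap_halves_lt:
  assumes "\<sigma> \<subseteq> {..<n}" "i < 2 * n"
  shows "swap_halves n \<sigma> i < 2 * n"
  using assms by (auto simp: swap_halves_def)

lemma swap_halves_involution:
  assumes "\<sigma> \<subseteq> {..<n}"
  shows "swap_halves n \<sigma> (swap_halves n \<sigma> i) = i"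
  using assms by (auto simp: swap_halves_def)

text \<open>Markov's inequality for each trace and a union bound over the traces. For a fixed trace
  the swaps act independently on the \<open>n\<close> pairs, so the sum over all swaps factors into
  terms \<open>\<phi> a b + \<phi> b a\<close>.\<close>

lemma card_swaps_le:
  fixes \<phi> :: "bool \<Rightarrow> bool \<Rightarrow> real" and \<kappa> \<theta> K :: real
  assumes \<phi>: "\<And>a b. \<phi> a b \<ge> 0" "\<And>a b. \<phi> a b + \<phi> b a \<le> 2 * \<kappa>" and \<theta>: "\<theta> > 0"
    and K: "real (card (traces G (2 * n) z)) \<le> K"
  shows "(\<Sum>\<sigma>\<in>Pow {..<n}. of_bool (\<exists>g\<in>G. \<theta> \<le> (\<Prod>i<n. \<phi> (g (z (swap_halves n \<sigma> i))) (g (z (swap_halves n \<sigma> (n + i)))))))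
    \<le> 2 ^ n * (K * \<kappa> ^ n / \<theta>)"
proof -
  define W where "W c \<sigma> = (\<Prod>i<n. \<phi> (c (swap_halves n \<sigma> i)) (c (swap_halves n \<sigma> (n + i))))" for c :: "nat \<Rightarrow> bool" and \<sigma>
  have W0: "W c \<sigma> \<ge> 0" for c \<sigma> unfolding W_def by (intro prod_nonneg) (auto simp: \<phi>)
  have W: "W c \<sigma> = (\<Prod>i\<in>\<sigma>. \<phi> (c (n + i)) (c i)) * (\<Prod>i\<in>{..<n} - \<sigma>. \<phi> (c i) (c (n + i)))" if "\<sigma> \<subseteq> {..<n}" for c \<sigma>
  proof -
    have "W c \<sigma> = (\<Prod>i\<in>\<sigma>. \<phi> (c (swap_halves n \<sigma> i)) (c (swap_halves n \<sigma> (n + i)))) *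
        (\<Prod>i\<in>{..<n} - \<sigma>. \<phi> (c (swap_halves n \<sigma> i)) (c (swap_halves n \<sigma> (n + i))))"
      unfolding W_def using prod.subset_diff[OF that, of "\<lambda>i. \<phi> (c (swap_halves n \<sigma> i)) (c (swap_halves n \<sigma> (n + i)))"]
      by (simp add: mult.commute)
    then show ?thesis
      using that by (auto simp: swap_halves_def subset_iff add.commute intro!: arg_cong2[where f = "(*)"] prod.cong)
  qed
  have "of_bool (\<exists>g\<in>G. \<theta> \<le> (\<Prod>i<n. \<phi> (g (z (swap_halves n \<sigma> i))) (g (z (swap_halves n \<sigma> (n + i))))))
      \<le> (\<Sum>c\<in>traces G (2 * n) z. W c \<sigma> / \<theta>)" (is "of_bool ?B \<le> _") if \<sigma>: "\<sigma> \<subseteq> {..<n}" for \<sigma>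
  proof (cases ?B)
    case True
    then obtain g where g: "g \<in> G" "\<theta> \<le> (\<Prod>i<n. \<phi> (g (z (swap_halves n \<sigma> i))) (g (z (swap_halves n \<sigma> (n + i)))))" by blast
    define c where "c = (\<lambda>i\<in>{..<2*n}. g (z i))"
    have "c \<in> traces G (2 * n) z" using g by (auto simp: traces_def c_def)
    have "W c \<sigma> = (\<Prod>i<n. \<phi> (g (z (swap_halves n \<sigma> i))) (g (z (swap_halves n \<sigma> (n + i)))))"
      unfolding W_def c_def using swap_halves_lt[OF \<sigma>] by (intro prod.cong) auto
    then have "1 \<le> W c \<sigma> / \<theta>" using g \<theta> by simp
    also have "\<dots> \<le> (\<Sum>c\<in>traces G (2 * n) z. W c \<sigma> / \<theta>)"
      using W0 \<theta> finite_traces \<open>c \<in> _\<close> by (intro member_le_sum[of c]) auto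
    finally show ?thesis by (simp add: True)
  next
    case False
    then show ?thesis using W0 \<theta> by (auto intro!: sum_nonneg simp: order_less_imp_le)
  qed
  then have "(\<Sum>\<sigma>\<in>Pow {..<n}. of_bool (\<exists>g\<in>G. \<theta> \<le> (\<Prod>i<n. \<phi> (g (z (swap_halves n \<sigma> i))) (g (z (swap_halves n \<sigma> (n + i)))))))
     \<le> (\<Sum>\<sigma>\<in>Pow {..<n}. \<Sum>c\<in>traces G (2 * n) z. W c \<sigma> / \<theta>)"
    by (intro sum_mono) auto
  also have "\<dots> = (\<Sum>c\<in>traces G (2 * n) z. (\<Sum>\<sigma>\<in>Pow {..<n}. W c \<sigma>) / \<theta>)"
    by (subst sum.swap) (simp add: sum_divide_distrib)
  \<comment> \<open>Expanding the product of binary sums gives one summand per subset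
    \<open>\<sigma>\<close>: swapped pairs contribute the first term, the others the second.\<close>
  also have "\<dots> = (\<Sum>c\<in>traces G (2 * n) z. (\<Prod>i<n. \<phi> (c (n + i)) (c i) + \<phi> (c i) (c (n + i))) / \<theta>)"
    by (subst prod_add) (auto intro!: sum.cong arg_cong2[where f = "(/)"] simp: W)
  also have "\<dots> \<le> (\<Sum>c\<in>traces G (2 * n) z. (\<Prod>i<n. 2 * \<kappa>) / \<theta>)"
    using \<phi> \<theta> by (intro sum_mono divide_right_mono prod_mono) auto
  also have "\<dots> = 2 ^ n * (real (card (traces G (2 * n) z)) * \<kappa> ^ n / \<theta>)"
    by (simp add: power_mult_distrib)
  also have "\<dots> \<le> 2 ^ n * (K * \<kappa> ^ n / \<theta>)"
    using K \<theta> \<phi>(1)[of True True] \<phi>(2)[of True True]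
    by (intro mult_left_mono divide_right_mono mult_right_mono) auto
  finally show ?thesis .
qed

text \<open>The measurability condition on hypothesis classes, relative to one measure on an
  arbitrary sample space, so that it can also be stated for disagreement regions and for losses on
  labelled points.\<close>

definition permissible :: "'z measure \<Rightarrow> ('z \<Rightarrow> bool) set \<Rightarrow> bool" where
  "permissible Q G \<longleftrightarrow> (\<forall>g\<in>G. g \<in> measurable Q (count_space UNIV)) \<and>
     (\<forall>(n :: nat) c. {z \<in> space (PiM {..<n} (\<lambda>_. Q)). \<exists>g\<in>G. \<forall>i<n. g (z i) = c i}
        \<in> sets (completion (PiM {..<n} (\<lambda>_. Q))))"

text \<open>A class has finitely many traces on \<open>m\<close> points, so any condition
  \<open>R\<close> on the trace, however irregular, is a finite union of basic trace events.\<close>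

lemma permissible_trace_event:
  fixes m :: nat
  assumes "permissible Q G"
  shows "{z \<in> space (PiM {..<m} (\<lambda>_. Q)). \<exists>g\<in>G. R (\<lambda>i\<in>{..<m}. g (z i))}
    \<in> sets (completion (PiM {..<m} (\<lambda>_. Q)))"
proof -
  let ?P = "PiM {..<m} (\<lambda>_. Q)"
  have "{z \<in> space ?P. \<exists>g\<in>G. R (\<lambda>i\<in>{..<m}. g (z i))} =
    (\<Union>c\<in>{c \<in> {..<m} \<rightarrow>\<^sub>E UNIV. R c}. {z \<in> space ?P. \<exists>g\<in>G. \<forall>i<m. g (z i) = c i})" (is "?L = ?R")
  proof (intro equalityI subsetI)
    fix z assume "z \<in> ?L"
    then obtain g where "z \<in> space ?P" "g \<in> G" "R (\<lambda>i\<in>{..<m}. g (z i))" by blast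
    then show "z \<in> ?R" by (intro UN_I[of "\<lambda>i\<in>{..<m}. g (z i)"]) auto
  next
    fix z assume "z \<in> ?R"
    then obtain c where "c \<in> {c \<in> {..<m} \<rightarrow>\<^sub>E UNIV. R c}"
      "z \<in> {z \<in> space ?P. \<exists>g\<in>G. \<forall>i<m. g (z i) = c i}" by (rule UN_E)
    then obtain g where c: "c \<in> {..<m} \<rightarrow>\<^sub>E UNIV" "R c" "z \<in> space ?P" "g \<in> G" "\<forall>i<m. g (z i) = c i"
      by auto
    then have "(\<lambda>i\<in>{..<m}. g (z i)) = c"
      by (auto simp: fun_eq_iff PiE_def extensional_def)
    then show "z \<in> ?L" using c by auto
  qed
  moreover have "finite {c \<in> {..<m} \<rightarrow>\<^sub>E (UNIV :: bool set). R c}"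
    by (rule finite_subset[of _ "{..<m} \<rightarrow>\<^sub>E (UNIV :: bool set)"]) (auto intro!: finite_PiE)
  ultimately show ?thesis
    using assms unfolding permissible_def by (auto intro!: sets.finite_UN)
qed

text \<open>
  The bad event \<open>B\<close> need not be measurable. Doubling the sample turns it into an event about finite
  traces, which is measurable up to null sets; a measurable superset of that event is used to
  integrate out the second half, and a measurable subset to average over the swaps.
\<close>

lemma symmetrization:
  fixes \<phi> :: "bool \<Rightarrow> bool \<Rightarrow> real" and \<kappa> \<theta> K :: real
  assumes Q: "prob_space Q" and G: "permissible Q G"
    and \<phi>: "\<And>a b. \<phi> a b \<ge> 0" "\<And>a b. \<phi> a b + \<phi> b a \<le> 2 * \<kappa>" and \<theta>: "\<theta> > 0"
    and K: "\<And>z. z \<in> space (PiM {..<2*n} (\<lambda>_. Q)) \<Longrightarrow> real (card (traces G (2 * n) z)) \<le> K"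
    and ghost: "\<And>x. x \<in> B \<Longrightarrow> x \<in> space (PiM {..<n} (\<lambda>_. Q)) \<Longrightarrow> \<exists>g\<in>G.
      1/2 \<le> measure (PiM {n..<2*n} (\<lambda>_. Q)) {y \<in> space (PiM {n..<2*n} (\<lambda>_. Q)). \<theta> \<le> (\<Prod>i<n. \<phi> (g (x i)) (g (y (n + i))))}"
  shows "\<exists>A\<in>sets (PiM {..<n} (\<lambda>_. Q)). A \<inter> B = {} \<and> measure (PiM {..<n} (\<lambda>_. Q)) A \<ge> 1 - 2 * (K * \<kappa> ^ n / \<theta>)"
proof -
  let ?P = "PiM {..<2*n} (\<lambda>_. Q)" and ?P1 = "PiM {..<n} (\<lambda>_. Q)" and ?P2 = "PiM {n..<2*n} (\<lambda>_. Q)"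
  interpret Q: prob_space Q by fact
  interpret PP: product_prob_space "\<lambda>_. Q" "{}" by standard
  interpret P: prob_space ?P by (rule prob_space_PiM) (rule Q)
  interpret P1: prob_space ?P1 by (rule prob_space_PiM) (rule Q)
  interpret P2: prob_space ?P2 by (rule prob_space_PiM) (rule Q)
  define \<delta> where "\<delta> = K * \<kappa> ^ n / \<theta>"
  define B2 where "B2 = {z \<in> space ?P. \<exists>g\<in>G. \<theta> \<le> (\<Prod>i<n. \<phi> (g (z i)) (g (z (n + i))))}"
  have "B2 = {z \<in> space ?P. \<exists>g\<in>G. (\<lambda>c. \<theta> \<le> (\<Prod>i<n. \<phi> (c i) (c (n + i)))) (\<lambda>i\<in>{..<2*n}. g (z i))}"
    unfolding B2_def by simp
  then have B2: "B2 \<in> sets (completion ?P)"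
    using permissible_trace_event[OF G, of "2*n" "\<lambda>c. \<theta> \<le> (\<Prod>i<n. \<phi> (c i) (c (n + i)))"] by simp
  obtain S N N' where SN: "B2 = S \<union> N" "N \<subseteq> N'" "N' \<in> null_sets ?P" "S \<in> sets ?P"
    using B2 by (rule sets_completionE)
  define U where "U = S \<union> N'"
  have U: "U \<in> sets ?P" "emeasure ?P U = emeasure ?P S" "B2 \<subseteq> U"
    using SN by (auto simp: U_def emeasure_Un_null_set)
  have S_le: "emeasure ?P S \<le> ennreal \<delta>"
  proof -
    define sw where "sw \<sigma> z = (\<lambda>i\<in>{..<2*n}. z (swap_halves n \<sigma> i))" for \<sigma> and z :: "nat \<Rightarrow> 'a"
    have distr: "distr ?P ?P (sw \<sigma>) = ?P" if "\<sigma> \<subseteq> {..<n}" for \<sigma>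
      unfolding sw_def
      using swap_halves_lt[OF that] swap_halves_involution[OF that]
      by (intro distr_PiM_reindex Q inj_on_inverseI[where g = "swap_halves n \<sigma>"]) auto
    have sw_meas: "sw \<sigma> \<in> measurable ?P ?P" if "\<sigma> \<subseteq> {..<n}" for \<sigma>
      unfolding sw_def using swap_halves_lt[OF that] by (auto intro!: measurable_restrict measurable_component_singleton)
    have S_eq: "emeasure ?P S = (\<integral>\<^sup>+ z. indicator S (sw \<sigma> z) \<partial>?P)" if "\<sigma> \<subseteq> {..<n}" for \<sigma>
    proof -
      have "emeasure ?P S = (\<integral>\<^sup>+ z. indicator S z \<partial>distr ?P ?P (sw \<sigma>))"
        using SN distr[OF that] by simp
      also have "\<dots> = (\<integral>\<^sup>+ z. indicator S (sw \<sigma> z) \<partial>?P)"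
        using SN sw_meas[OF that] by (subst nn_integral_distr) auto
      finally show ?thesis .
    qed
    \<comment> \<open>Since each swap preserves the product measure, the measure of \<open>S\<close>
      equals its average over all swaps; exchanging sum and integral leaves a counting problem for
      each fixed sample.\<close>
    have "2 ^ n * emeasure ?P S = (\<Sum>\<sigma>\<in>Pow {..<n}. emeasure ?P S)"
      by (simp add: card_Pow)
    also have "\<dots> = (\<Sum>\<sigma>\<in>Pow {..<n}. \<integral>\<^sup>+ z. indicator S (sw \<sigma> z) \<partial>?P)"
      using S_eq by (intro sum.cong) auto
    also have "\<dots> = (\<integral>\<^sup>+ z. (\<Sum>\<sigma>\<in>Pow {..<n}. indicator S (sw \<sigma> z)) \<partial>?P)"
      using SN sw_meas by (intro nn_integral_sum[symmetric]) (auto intro: measurable_compose)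
    also have "\<dots> \<le> (\<integral>\<^sup>+ z. ennreal (2 ^ n * \<delta>) \<partial>?P)"
    proof (intro nn_integral_mono)
      fix z assume z: "z \<in> space ?P"
      have "(\<Sum>\<sigma>\<in>Pow {..<n}. indicator S (sw \<sigma> z) :: ennreal) = ennreal (\<Sum>\<sigma>\<in>Pow {..<n}. indicator S (sw \<sigma> z))"
        by (subst sum_ennreal[symmetric]) (auto simp: ennreal_indicator)
      also have "\<dots> \<le> ennreal (\<Sum>\<sigma>\<in>Pow {..<n}. of_bool (\<exists>g\<in>G. \<theta> \<le> (\<Prod>i<n. \<phi> (g (z (swap_halves n \<sigma> i))) (g (z (swap_halves n \<sigma> (n + i)))))))"
      proof (intro ennreal_leI sum_mono)
        fix \<sigma> assume "\<sigma> \<in> Pow {..<n}"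
        then have \<sigma>: "\<sigma> \<subseteq> {..<n}" by simp
        have "\<exists>g\<in>G. \<theta> \<le> (\<Prod>i<n. \<phi> (g (z (swap_halves n \<sigma> i))) (g (z (swap_halves n \<sigma> (n + i)))))"
          if "sw \<sigma> z \<in> S"
        proof -
          have "sw \<sigma> z \<in> B2" using that SN(1) by blast
          then show ?thesis by (simp add: B2_def sw_def)
        qed
        then show "indicator S (sw \<sigma> z) \<le> (of_bool (\<exists>g\<in>G. \<theta> \<le> (\<Prod>i<n. \<phi> (g (z (swap_halves n \<sigma> i))) (g (z (swap_halves n \<sigma> (n + i)))))) :: real)"
          by (simp add: indicator_def)
      qed
      also have "\<dots> \<le> ennreal (2 ^ n * \<delta>)"
        unfolding \<delta>_def by (intro ennreal_leI card_swaps_le \<phi> \<theta> K z)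
      finally show "(\<Sum>\<sigma>\<in>Pow {..<n}. indicator S (sw \<sigma> z) :: ennreal) \<le> ennreal (2 ^ n * \<delta>)" .
    qed
    also have "\<dots> = 2 ^ n * ennreal \<delta>"
      by (simp add: P.emeasure_space_1 ennreal_mult' ennreal_power[symmetric])
    finally show ?thesis
      by (subst (asm) ennreal_mult_le_mult_iff) (auto simp: power_eq_top_ennreal)
  qed
  define F where "F x = (\<integral>\<^sup>+ y. indicator U (merge {..<n} {n..<2*n} (x, y)) \<partial>?P2)" for x
  have disj: "{..<n} \<inter> {n..<2*n} = {}" and union: "{..<n} \<union> {n..<2*n} = {..<2*n}" by auto
  have merge_meas: "merge {..<n} {n..<2*n} \<in> measurable (?P1 \<Otimes>\<^sub>M ?P2) ?P"
    using measurable_merge[of "{..<n}" "{n..<2*n}" "\<lambda>_. Q"] unfolding union .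
  have [measurable]: "U \<in> sets ?P" by (rule U)
  have F_meas[measurable]: "F \<in> borel_measurable ?P1"
    unfolding F_def
    using measurable_compose[OF merge_meas borel_measurable_indicator[OF U(1)]]
    by (intro P2.borel_measurable_nn_integral) (simp add: split_beta')
  have F_int: "(\<integral>\<^sup>+ x. F x \<partial>?P1) = emeasure ?P U"
    unfolding F_def
    using PP.product_nn_integral_fold[OF disj, of "indicator U"] U unfolding union by simp
  \<comment> \<open>The threshold matches the hypothesis \<open>ghost\<close>: over a bad first half
    the section of \<open>U\<close> has measure at least \<open>1/2\<close>. Markov's inequality at
    this threshold costs the factor 2 in the conclusion.\<close>
  define A where "A = {x \<in> space ?P1. F x < ennreal (1/2)}"
  have A: "A \<in> sets ?P1" unfolding A_def by measurable
  have "A \<inter> B = {}"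
  proof (rule ccontr)
    assume "A \<inter> B \<noteq> {}"
    then obtain x where x: "x \<in> B" "x \<in> space ?P1" "F x < ennreal (1/2)" by (auto simp: A_def)
    obtain g where g: "g \<in> G" and
      half: "1/2 \<le> measure ?P2 {y \<in> space ?P2. \<theta> \<le> (\<Prod>i<n. \<phi> (g (x i)) (g (y (n + i))))}" (is "_ \<le> measure _ ?V")
      using ghost[OF x(1,2)] by blast
    have [measurable]: "g \<in> measurable Q (count_space UNIV)" using G g by (auto simp: permissible_def)
    have V: "?V \<in> sets ?P2"
    proof -
      have [measurable]: "(\<lambda>y. \<phi> (g (x i)) (g (y (n + i)))) \<in> borel_measurable ?P2" if "i < n" for i
      proof -
        have [measurable]: "(\<lambda>y. y (n + i)) \<in> measurable ?P2 Q"
          using that by (intro measurable_component_singleton) auto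
        show ?thesis by measurable
      qed
      have "(\<lambda>y. \<Prod>i<n. \<phi> (g (x i)) (g (y (n + i)))) \<in> borel_measurable ?P2"
        by (intro borel_measurable_prod) auto
      then show ?thesis by measurable
    qed
    have "ennreal (1/2) \<le> emeasure ?P2 ?V"
      using ennreal_leI[OF half] unfolding P2.emeasure_eq_measure .
    also have "\<dots> = (\<integral>\<^sup>+ y. indicator ?V y \<partial>?P2)" using V by simp
    also have "\<dots> \<le> F x" unfolding F_def
    proof (intro nn_integral_mono)
      fix y assume y: "y \<in> space ?P2"
      have "merge {..<n} {n..<2*n} (x, y) \<in> B2" if "y \<in> ?V"
      proof -
        have "merge {..<n} {n..<2*n} (x, y) \<in> space ?P"
          using measurable_space[OF merge_meas, of "(x, y)"] x y by (auto simp: space_pair_measure)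
        moreover have "(\<Prod>i<n. \<phi> (g (merge {..<n} {n..<2*n} (x, y) i)) (g (merge {..<n} {n..<2*n} (x, y) (n + i)))) =
            (\<Prod>i<n. \<phi> (g (x i)) (g (y (n + i))))"
          by (intro prod.cong) (auto simp: merge_def)
        ultimately show ?thesis using that g unfolding B2_def by (auto intro!: bexI[of _ g])
      qed
      then show "indicator ?V y \<le> (indicator U (merge {..<n} {n..<2*n} (x, y)) :: ennreal)"
        using U(3) by (auto simp: indicator_def)
    qed
    finally show False using x(3) leD by blast
  qed
  moreover have "measure ?P1 A \<ge> 1 - 2 * \<delta>"
  proof -
    \<comment> \<open>Needed to return from \<open>ennreal\<close>, where negative reals collapse to
      0. \<open>K\<close> is nonnegative because it bounds a cardinality at some sample.\<close>
    have \<delta>0: "\<delta> \<ge> 0"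
    proof -
      obtain z where "z \<in> space ?P" using P.not_empty by blast
      then have "K \<ge> 0" using K[of z] of_nat_0_le_iff order_trans by blast
      moreover have "\<kappa> \<ge> 0" using \<phi>(1)[of True True] \<phi>(2)[of True True] by simp
      ultimately show ?thesis using \<theta> by (simp add: \<delta>_def)
    qed
    have "ennreal (1/2 * measure ?P1 (space ?P1 - A)) = ennreal (1/2) * emeasure ?P1 (space ?P1 - A)"
      unfolding P1.emeasure_eq_measure by (rule ennreal_mult') simp
    also have "\<dots> = (\<integral>\<^sup>+ x. ennreal (1/2) * indicator (space ?P1 - A) x \<partial>?P1)"
      using A by (subst nn_integral_cmult_indicator) auto
    also have "\<dots> \<le> (\<integral>\<^sup>+ x. F x \<partial>?P1)"
    proof (intro nn_integral_mono)
      fix x assume "x \<in> space ?P1"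
      then show "ennreal (1/2) * indicator (space ?P1 - A) x \<le> F x"
        unfolding A_def indicator_def by (cases "F x < ennreal (1/2)") (simp_all del: ennreal_divide_numeral add: not_less)
    qed
    also have "\<dots> \<le> ennreal \<delta>" using F_int U(2) S_le by simp
    finally have "measure ?P1 (space ?P1 - A) \<le> 2 * \<delta>" using \<delta>0 by simp
    then show ?thesis using P1.prob_compl[OF A] by simp
  qed
  ultimately show ?thesis using A unfolding \<delta>_def by blast
qed

section \<open>Nets and uniform convergence\<close>

lemma measurable_ghost_sum:
  fixes n :: nat and c :: real
  assumes [measurable]: "g \<in> measurable Q (count_space UNIV)"
  shows "{y \<in> space (PiM {n..<2*n} (\<lambda>_. Q)). c \<le> (\<Sum>i<n. of_bool (g (y (n + i))))} \<in> sets (PiM {n..<2*n} (\<lambda>_. Q))"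
proof -
  have [measurable]: "(\<lambda>y. of_bool (g (y (n + i))) :: real) \<in> borel_measurable (PiM {n..<2*n} (\<lambda>_. Q))"
    if "i < n" for i
  proof -
    have [measurable]: "(\<lambda>y. y (n + i)) \<in> measurable (PiM {n..<2*n} (\<lambda>_. Q)) Q"
      using that by (intro measurable_component_singleton) auto
    show ?thesis by measurable
  qed
  have "(\<lambda>y. \<Sum>i<n. of_bool (g (y (n + i))) :: real) \<in> borel_measurable (PiM {n..<2*n} (\<lambda>_. Q))"
    by (intro borel_measurable_sum) auto
  then show ?thesis by measurable
qed

text \<open>The condition \<open>2 * n * p \<le> s\<^sup>2\<close> makes the Chernoff bound at most
  \<open>exp (- 1)\<close>, which is below \<open>1 / 2\<close>.\<close>

lemma ghost_sample:
  fixes s p :: real and n :: nat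
  assumes Q: "prob_space Q" and g: "g \<in> measurable Q (count_space UNIV)"
    and p: "measure Q {z \<in> space Q. g z} = p" "p > 0" and s: "s \<ge> 0" "2 * n * p \<le> s\<^sup>2" and n: "n > 0"
  shows "1 / 2 \<le> measure (PiM {n..<2*n} (\<lambda>_. Q))
    {y \<in> space (PiM {n..<2*n} (\<lambda>_. Q)). n * p - s \<le> (\<Sum>i<n. of_bool (g (y (n + i))))}"
    (is "_ \<le> measure ?P ?V")
proof -
  interpret Q: prob_space Q by fact
  interpret P: prob_space ?P by (rule prob_space_PiM) (rule Q)
  define E where "E = {z \<in> space Q. g z}"
  have [measurable]: "E \<in> sets Q" unfolding E_def using g by measurable
  have sum_eq: "(\<Sum>j\<in>{n..<2*n}. indicator E (y j)) = (\<Sum>i<n. of_bool (g (y (n + i))) :: real)"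
    if "y \<in> space ?P" for y
  proof -
    have "(\<Sum>j\<in>{n..<2*n}. indicator E (y j) :: real) = (\<Sum>i<n. indicator E (y (n + i)))"
      by (rule sum.reindex_bij_witness[of _ "\<lambda>i. n + i" "\<lambda>j. j - n"]) auto
    also have "\<dots> = (\<Sum>i<n. of_bool (g (y (n + i))))"
      using that by (intro sum.cong) (auto simp: E_def space_PiM PiE_iff)
    finally show ?thesis .
  qed
  define W where "W = {y \<in> space ?P. (\<Sum>j\<in>{n..<2*n}. indicator E (y j)) < n * p - s}"
  have W: "W \<in> sets ?P" unfolding W_def by measurable
  have "P.prob W \<le> exp (- (s\<^sup>2 / (2 * n * p)))"
    using Q.chernoff_lower_tail[of "{n..<2*n}" E s] \<open>E \<in> sets Q\<close> p s(1) n by (simp add: W_def E_def)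
  also have "\<dots> \<le> exp (- 1)"
    using s n p by (simp add: field_simps)
  also have "\<dots> \<le> 1 / 2"
    using exp_ge_add_one_self[of 1] by (simp add: exp_minus field_simps)
  finally have "1 / 2 \<le> P.prob (space ?P - W)" using P.prob_compl[OF W] by simp
  also have "space ?P - W = ?V"
    unfolding W_def using sum_eq by auto
  finally show ?thesis .
qed

text \<open>If the first half misses a region and the second half meets it \<open>k\<close> times,
  only about one swap in \<open>2 ^ k\<close> preserves the miss. The ghost sample supplies
  \<open>k\<close> of at least \<open>n * \<alpha> / 2\<close>.\<close>

lemma epsilon_net:
  fixes K \<alpha> :: real and n :: nat
  assumes Q: "prob_space Q" and G: "permissible Q G"
    and K: "\<And>z. z \<in> space (PiM {..<2*n} (\<lambda>_. Q)) \<Longrightarrow> real (card (traces G (2 * n) z)) \<le> K"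
    and n: "n * \<alpha> \<ge> 8" and \<alpha>: "\<alpha> > 0"
  shows "\<exists>A\<in>sets (PiM {..<n} (\<lambda>_. Q)). measure (PiM {..<n} (\<lambda>_. Q)) A \<ge> 1 - 2 * (K * 2 powr (- (n * \<alpha> / 2))) \<and>
    (\<forall>x\<in>A. \<forall>g\<in>G. (\<forall>i<n. \<not> g (x i)) \<longrightarrow> measure Q {z \<in> space Q. g z} \<le> \<alpha>)"
proof -
  interpret Q: prob_space Q by fact
  interpret P2: prob_space "PiM {n..<2*n} (\<lambda>_. Q)" by (rule prob_space_PiM) (rule Q)
  define B where "B = {x. \<exists>g\<in>G. (\<forall>i<n. \<not> g (x i)) \<and> measure Q {z \<in> space Q. g z} > \<alpha>}"
  \<comment> \<open>The weight vanishes on a hit in the first half and doubles for each hit in the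
    second half. The symmetric sums are 0 or 2, so \<open>\<kappa> = 1\<close> and swapping loses
    nothing.\<close>
  define \<phi> :: "bool \<Rightarrow> bool \<Rightarrow> real" where "\<phi> a b = (if a then 0 else if b then 2 else 1)" for a b
  have "\<exists>A\<in>sets (PiM {..<n} (\<lambda>_. Q)). A \<inter> B = {} \<and>
    measure (PiM {..<n} (\<lambda>_. Q)) A \<ge> 1 - 2 * (K * 1 ^ n / 2 powr (n * \<alpha> / 2))"
  proof (rule symmetrization[OF Q G _ _ _ K, where \<phi> = \<phi>])
    show "\<phi> a b \<ge> 0" "\<phi> a b + \<phi> b a \<le> 2 * 1" for a b by (auto simp: \<phi>_def)
    fix x assume "x \<in> B"
    then obtain g where g: "g \<in> G" "\<forall>i<n. \<not> g (x i)" "measure Q {z \<in> space Q. g z} > \<alpha>"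
      by (auto simp: B_def)
    define p where "p = measure Q {z \<in> space Q. g z}"
    have g_meas: "g \<in> measurable Q (count_space UNIV)" using G g(1) by (simp add: permissible_def)
    have p: "p > \<alpha>" "p > 0" using g(3) \<alpha> by (auto simp: p_def)
    have n0: "n > 0" using n by (cases n) auto
    \<comment> \<open>The ghost sample is used with \<open>s = n * p / 2\<close>, half the mean; the
      required \<open>2 * n * p \<le> s\<^sup>2\<close> then amounts to
      \<open>n * p \<ge> 8\<close>.\<close>
    have "8 \<le> n * p" using n p mult_left_mono[of \<alpha> p "real n"] by simp
    then have "2 * n * p \<le> (n * p / 2)\<^sup>2"
      using mult_right_mono[of 8 "n * p" "n * p"] p by (simp add: power2_eq_square field_simps)
    then have "1 / 2 \<le> measure (PiM {n..<2*n} (\<lambda>_. Q))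
      {y \<in> space (PiM {n..<2*n} (\<lambda>_. Q)). n * p - n * p / 2 \<le> (\<Sum>i<n. of_bool (g (y (n + i))))}"
      using G g(1) p n0 by (intro ghost_sample[OF Q]) (auto simp: permissible_def p_def)
    also have "\<dots> \<le> measure (PiM {n..<2*n} (\<lambda>_. Q))
       {y \<in> space (PiM {n..<2*n} (\<lambda>_. Q)). 2 powr (n * \<alpha> / 2) \<le> (\<Prod>i<n. \<phi> (g (x i)) (g (y (n + i))))}"
    proof -
      have "(\<Prod>i<n. \<phi> (g (x i)) (g (y (n + i)))) = 2 powr (\<Sum>i<n. of_bool (g (y (n + i))))" for y
      proof -
        have "(\<Prod>i<n. \<phi> (g (x i)) (g (y (n + i)))) = (\<Prod>i<n. 2 powr of_bool (g (y (n + i))))"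
          using g(2) by (intro prod.cong) (auto simp: \<phi>_def)
        then show ?thesis by (simp add: powr_sum del: sum_of_bool_eq)
      qed
      then have iff: "2 powr (n * \<alpha> / 2) \<le> (\<Prod>i<n. \<phi> (g (x i)) (g (y (n + i)))) \<longleftrightarrow>
          n * \<alpha> / 2 \<le> (\<Sum>i<n. of_bool (g (y (n + i))))" for y
        by (simp del: sum_of_bool_eq)
      have "n * \<alpha> / 2 \<le> n * p - n * p / 2"
        using mult_left_mono[of \<alpha> p "real n"] p by (simp add: mult.commute)
      then show ?thesis unfolding iff
        by (intro P2.finite_measure_mono measurable_ghost_sum Collect_mono conj_mono g_meas)
           (auto simp del: sum_of_bool_eq)
    qed
    finally show "\<exists>g\<in>G. 1 / 2 \<le> measure (PiM {n..<2*n} (\<lambda>_. Q))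
       {y \<in> space (PiM {n..<2*n} (\<lambda>_. Q)). 2 powr (n * \<alpha> / 2) \<le> (\<Prod>i<n. \<phi> (g (x i)) (g (y (n + i))))}"
      using g(1) by blast
  qed auto
  then obtain A where A: "A \<in> sets (PiM {..<n} (\<lambda>_. Q))" "A \<inter> B = {}"
    "measure (PiM {..<n} (\<lambda>_. Q)) A \<ge> 1 - 2 * (K * 1 ^ n / 2 powr (n * \<alpha> / 2))" by blast
  have good: "measure Q {z \<in> space Q. g z} \<le> \<alpha>" if "x \<in> A" "g \<in> G" "\<forall>i<n. \<not> g (x i)" for x g
  proof (rule ccontr)
    assume "\<not> ?thesis"
    then have "x \<in> B" unfolding B_def using that by (intro CollectI bexI[of _ g]) auto
    then show False using A(2) that(1) by blast
  qed
  have "measure (PiM {..<n} (\<lambda>_. Q)) A \<ge> 1 - 2 * (K * 2 powr (- (n * \<alpha> / 2)))"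
    using A(3) unfolding power_one mult_1_right divide_inverse[of K] powr_minus .
  then show ?thesis using good by (intro bexI[OF _ A(1)] conjI ballI impI) simp_all
qed

text \<open>One-sided on purpose: the other direction follows by applying it to the complements of
  the class.\<close>

lemma uniform_convergence:
  fixes K \<alpha> :: real and n :: nat
  assumes Q: "prob_space Q" and G: "permissible Q G"
    and K: "\<And>z. z \<in> space (PiM {..<2*n} (\<lambda>_. Q)) \<Longrightarrow> real (card (traces G (2 * n) z)) \<le> K"
    and n: "n * \<alpha>\<^sup>2 \<ge> 8" and \<alpha>: "\<alpha> > 0" "\<alpha> \<le> 1"
  shows "\<exists>A\<in>sets (PiM {..<n} (\<lambda>_. Q)). measure (PiM {..<n} (\<lambda>_. Q)) A \<ge> 1 - 2 * (K * exp (- (n * \<alpha>\<^sup>2 / 16))) \<and>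
    (\<forall>x\<in>A. \<forall>g\<in>G. measure Q {z \<in> space Q. g z} \<le> 1 / n * (\<Sum>i<n. of_bool (g (x i))) + \<alpha>)"
proof -
  interpret Q: prob_space Q by fact
  interpret P2: prob_space "PiM {n..<2*n} (\<lambda>_. Q)" by (rule prob_space_PiM) (rule Q)
  define B where "B = {x. \<exists>g\<in>G. measure Q {z \<in> space Q. g z} > 1 / n * (\<Sum>i<n. of_bool (g (x i))) + \<alpha>}"
  \<comment> \<open>Minimizer of \<open>l^2 - l * \<alpha> / 2\<close>, the exponent per sample
    point; the minimum is \<open>- \<alpha>^2 / 16\<close>.\<close>
  define l where "l = \<alpha> / 4"
  have l: "l > 0" "l \<le> 1" using \<alpha> by (auto simp: l_def)
  define \<phi> :: "bool \<Rightarrow> bool \<Rightarrow> real" where "\<phi> a b = exp (l * (of_bool b - of_bool a))" for a b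
  have n0: "n > 0" using n by (cases n) auto
  have "\<exists>A\<in>sets (PiM {..<n} (\<lambda>_. Q)). A \<inter> B = {} \<and>
    measure (PiM {..<n} (\<lambda>_. Q)) A \<ge> 1 - 2 * (K * exp (l\<^sup>2) ^ n / exp (l * (n * \<alpha> / 2)))"
  proof (rule symmetrization[OF Q G _ _ _ K, where \<phi> = \<phi>])
    show "\<phi> a b \<ge> 0" for a b by (auto simp: \<phi>_def)
    \<comment> \<open>A pair with distinct labels contributes \<open>exp l + exp (- l)\<close>, at
      most \<open>2 * exp (l^2)\<close>: a hyperbolic cosine estimate with room to spare.\<close>
    have "exp l \<le> 1 + l + l\<^sup>2" "exp (- l) \<le> 1 - l + l\<^sup>2 / 2" "0 \<le> l\<^sup>2"
      using exp_bound[of l] exp_minus_le_quadratic[of l] l by auto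
    then have "exp l + exp (- l) \<le> (1 + l + l\<^sup>2) + (1 - l + l\<^sup>2 / 2)" by (intro add_mono)
    also have "\<dots> \<le> 2 * (1 + l\<^sup>2)" by (simp add: field_simps)
    also have "\<dots> \<le> 2 * exp (l\<^sup>2)" by (intro mult_left_mono exp_ge_add_one_self) simp
    finally show "\<phi> a b + \<phi> b a \<le> 2 * exp (l\<^sup>2)" for a b by (auto simp: \<phi>_def)
    fix x assume "x \<in> B"
    then obtain g where g: "g \<in> G" "measure Q {z \<in> space Q. g z} > 1 / n * (\<Sum>i<n. of_bool (g (x i))) + \<alpha>"
      by (auto simp: B_def)
    define p where "p = measure Q {z \<in> space Q. g z}"
    have x0: "0 \<le> 1 / n * (\<Sum>i<n. of_bool (g (x i)) :: real)" by (simp add: sum_nonneg)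
    have g_meas: "g \<in> measurable Q (count_space UNIV)" using G g(1) by (simp add: permissible_def)
    have p: "p > 0" "p \<le> 1" using g(2) \<alpha> x0 unfolding p_def by (linarith, simp)
    have mean: "n * p \<ge> (\<Sum>i<n. of_bool (g (x i))) + n * \<alpha>"
      using g(2) n0 by (simp add: p_def field_simps)
    \<comment> \<open>Half of the deviation \<open>n * \<alpha>\<close> is granted to the ghost
      sample, and the swaps have to produce the other half. With \<open>p \<le> 1\<close>, the
      assumption on \<open>n\<close> gives the condition of \<open>ghost_sample\<close> for
      \<open>s = n * \<alpha> / 2\<close>.\<close>
    have "8 * p \<le> 8" using p by simp
    also have "\<dots> \<le> n * \<alpha>\<^sup>2" by (rule n)
    finally have "n * (8 * p) \<le> n * (n * \<alpha>\<^sup>2)" by (intro mult_left_mono) auto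
    then have "2 * n * p \<le> (n * \<alpha> / 2)\<^sup>2"
      by (simp add: power2_eq_square field_simps)
    then have "1 / 2 \<le> measure (PiM {n..<2*n} (\<lambda>_. Q))
      {y \<in> space (PiM {n..<2*n} (\<lambda>_. Q)). n * p - n * \<alpha> / 2 \<le> (\<Sum>i<n. of_bool (g (y (n + i))))}"
      using G g(1) p n0 \<alpha> by (intro ghost_sample[OF Q]) (auto simp: permissible_def p_def)
    also have "\<dots> \<le> measure (PiM {n..<2*n} (\<lambda>_. Q))
       {y \<in> space (PiM {n..<2*n} (\<lambda>_. Q)). exp (l * (n * \<alpha> / 2)) \<le> (\<Prod>i<n. \<phi> (g (x i)) (g (y (n + i))))}"
    proof -
      have prod: "(\<Prod>i<n. \<phi> (g (x i)) (g (y (n + i)))) =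
          exp (l * ((\<Sum>i<n. of_bool (g (y (n + i)))) - (\<Sum>i<n. of_bool (g (x i)))))" for y
        unfolding \<phi>_def exp_sum[OF finite_lessThan, symmetric]
        by (simp add: sum_distrib_left sum_subtractf right_diff_distrib)
      have iff: "exp (l * (n * \<alpha> / 2)) \<le> (\<Prod>i<n. \<phi> (g (x i)) (g (y (n + i)))) \<longleftrightarrow>
          n * \<alpha> / 2 + (\<Sum>i<n. of_bool (g (x i))) \<le> (\<Sum>i<n. of_bool (g (y (n + i))))" for y
        unfolding prod exp_le_cancel_iff mult_le_cancel_left_pos[OF l(1)] by linarith
      show ?thesis unfolding iff
        using mean
        by (intro P2.finite_measure_mono measurable_ghost_sum Collect_mono conj_mono g_meas)
           (auto simp del: sum_of_bool_eq)
    qed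
    finally show "\<exists>g\<in>G. 1 / 2 \<le> measure (PiM {n..<2*n} (\<lambda>_. Q))
       {y \<in> space (PiM {n..<2*n} (\<lambda>_. Q)). exp (l * (n * \<alpha> / 2)) \<le> (\<Prod>i<n. \<phi> (g (x i)) (g (y (n + i))))}"
      using g(1) by blast
  qed auto
  then obtain A where A: "A \<in> sets (PiM {..<n} (\<lambda>_. Q))" "A \<inter> B = {}"
    "measure (PiM {..<n} (\<lambda>_. Q)) A \<ge> 1 - 2 * (K * exp (l\<^sup>2) ^ n / exp (l * (n * \<alpha> / 2)))" by blast
  have good: "measure Q {z \<in> space Q. g z} \<le> 1 / n * (\<Sum>i<n. of_bool (g (x i))) + \<alpha>" if "x \<in> A" "g \<in> G" for x g
  proof (rule ccontr)
    assume "\<not> ?thesis"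
    then have "x \<in> B" unfolding B_def using that by (intro CollectI bexI[of _ g]) auto
    then show False using A(2) that(1) by blast
  qed
  have "exp (l\<^sup>2) ^ n / exp (l * (n * \<alpha> / 2)) = exp (- (n * \<alpha>\<^sup>2 / 16))"
    unfolding exp_of_nat_mult[symmetric] exp_diff[symmetric] l_def
    by (simp add: power2_eq_square)
  then have "measure (PiM {..<n} (\<lambda>_. Q)) A \<ge> 1 - 2 * (K * exp (- (n * \<alpha>\<^sup>2 / 16)))"
    using A(3) by (simp only: times_divide_eq_right[symmetric])
  then show ?thesis using good by (intro bexI[OF _ A(1)] conjI ballI impI)
qed

section \<open>Traces of disagreement and loss classes\<close>

text \<open>A pair realizes \<open>c\<close> exactly when one member has some trace \<open>e\<close>
  and the other has the trace \<open>e\<close> xor \<open>c\<close>. Ranging over the finitely many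
  \<open>e\<close> reduces the event to intersections of trace events of \<open>G\<close>.\<close>

lemma permissible_disagreement:
  assumes "permissible Q G"
  shows "permissible Q ((\<lambda>(g, g') z. g z \<noteq> g' z) ` (G \<times> G))"
  unfolding permissible_def
proof (intro conjI ballI allI)
  fix f assume "f \<in> (\<lambda>(g, g') z. g z \<noteq> g' z) ` (G \<times> G)"
  then obtain g g' where f: "g \<in> G" "g' \<in> G" "f = (\<lambda>z. g z \<noteq> g' z)" by auto
  then have [measurable]: "g \<in> measurable Q (count_space UNIV)" "g' \<in> measurable Q (count_space UNIV)"
    using assms by (auto simp: permissible_def)
  show "f \<in> measurable Q (count_space UNIV)" unfolding f by measurable
next
  fix n :: nat and c
  let ?P = "PiM {..<n} (\<lambda>_. Q)"
  let ?T = "\<lambda>c. {z \<in> space ?P. \<exists>g\<in>G. \<forall>i<n. g (z i) = c i}"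
  have "{z \<in> space ?P. \<exists>g\<in>(\<lambda>(g, g') z. g z \<noteq> g' z) ` (G \<times> G). \<forall>i<n. g (z i) = c i} =
      (\<Union>e\<in>{..<n} \<rightarrow>\<^sub>E UNIV. ?T e \<inter> ?T (\<lambda>i. e i \<noteq> c i))" (is "?L = ?R")
  proof (intro equalityI subsetI)
    fix z assume "z \<in> ?L"
    then obtain g g' where g: "z \<in> space ?P" "g \<in> G" "g' \<in> G" "\<forall>i<n. (g (z i) \<noteq> g' (z i)) = c i" by auto
    then have g': "\<forall>i<n. g' (z i) = (g (z i) \<noteq> c i)" by blast
    have "z \<in> ?T (\<lambda>i\<in>{..<n}. g (z i))" "z \<in> ?T (\<lambda>i. (\<lambda>i\<in>{..<n}. g (z i)) i \<noteq> c i)"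
      using g(1-3) g' by auto
    then show "z \<in> ?R" by (intro UN_I[of "\<lambda>i\<in>{..<n}. g (z i)"] IntI) simp_all
  next
    fix z assume "z \<in> ?R"
    then obtain e where "e \<in> {..<n} \<rightarrow>\<^sub>E (UNIV :: bool set)" "z \<in> ?T e \<inter> ?T (\<lambda>i. e i \<noteq> c i)" by (rule UN_E)
    then obtain g g' where g: "z \<in> space ?P" "g \<in> G" "g' \<in> G" "\<forall>i<n. g (z i) = e i" "\<forall>i<n. g' (z i) = (e i \<noteq> c i)"
      by auto
    then have *: "\<forall>i<n. (g (z i) \<noteq> g' (z i)) = c i" by blast
    have "(\<lambda>z. g z \<noteq> g' z) \<in> (\<lambda>(g, g') z. g z \<noteq> g' z) ` (G \<times> G)"
      using g by (intro image_eqI[of _ _ "(g, g')"]) simp_all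
    from bexI[where P = "\<lambda>f. \<forall>i<n. f (z i) = c i", OF * this] g(1)
    show "z \<in> ?L" by simp
  qed
  also have "\<dots> \<in> sets (completion ?P)"
    using assms unfolding permissible_def by (intro sets.finite_UN sets.Int finite_PiE) auto
  finally show "{z \<in> space ?P. \<exists>g\<in>(\<lambda>(g, g') z. g z \<noteq> g' z) ` (G \<times> G). \<forall>i<n. g (z i) = c i}
    \<in> sets (completion ?P)" .
qed

text \<open>The trace of a disagreement region is determined by the pair of traces, hence the
  square.\<close>

lemma card_traces_disagreement:
  "card (traces ((\<lambda>(g, g') z. g z \<noteq> g' z) ` (G \<times> G)) m z) \<le> (card (traces G m z))\<^sup>2"
proof -
  have "traces ((\<lambda>(g, g') z. g z \<noteq> g' z) ` (G \<times> G)) m z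
    \<subseteq> (\<lambda>(c, c'). \<lambda>i\<in>{..<m}. c i \<noteq> c' i) ` (traces G m z \<times> traces G m z)"
  proof
    fix e assume "e \<in> traces ((\<lambda>(g, g') z. g z \<noteq> g' z) ` (G \<times> G)) m z"
    then obtain g g' where "g \<in> G" "g' \<in> G" "e = (\<lambda>i\<in>{..<m}. g (z i) \<noteq> g' (z i))" by (auto simp: traces_def)
    then show "e \<in> (\<lambda>(c, c'). \<lambda>i\<in>{..<m}. c i \<noteq> c' i) ` (traces G m z \<times> traces G m z)"
      by (intro image_eqI[of _ _ "(\<lambda>i\<in>{..<m}. g (z i), \<lambda>i\<in>{..<m}. g' (z i))"])
         (auto simp: traces_def restrict_def fun_eq_iff)
  qed
  from card_mono[OF _ this] have "card (traces ((\<lambda>(g, g') z. g z \<noteq> g' z) ` (G \<times> G)) m z)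
    \<le> card ((\<lambda>(c, c'). \<lambda>i\<in>{..<m}. c i \<noteq> c' i) ` (traces G m z \<times> traces G m z))"
    by (simp add: finite_traces)
  also have "\<dots> \<le> card (traces G m z \<times> traces G m z)"
    by (intro card_image_le finite_cartesian_product finite_traces)
  finally show ?thesis by (simp add: card_cartesian_product power2_eq_square)
qed

text \<open>A trace is determined by the dichotomy of the set of distinct sample points, of which
  there are at most \<open>m\<close>.\<close>

lemma card_traces_le:
  fixes t :: real
  assumes VC: "VC X H = enat d" and z: "\<And>i. i < m \<Longrightarrow> z i \<in> X" and t: "0 < t" "t \<le> 1"
  shows "real (card (traces H m z)) \<le> (1 / t) ^ d * exp (t * m)"
proof -
  let ?A = "z ` {..<m}"
  have fin: "finite (dichotomies H ?A)" by (intro finite_dichotomies) simp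
  have "traces H m z = (\<lambda>c. \<lambda>i\<in>{..<m}. c (z i)) ` dichotomies H ?A"
    by (auto simp: traces_def dichotomies_def image_image restrict_def fun_eq_iff intro!: image_cong)
  then have "card (traces H m z) \<le> card (dichotomies H ?A)"
    using card_image_le[OF fin] by simp
  then have "real (card (traces H m z)) \<le> (1 / t) ^ d * exp (t * card ?A)"
    using card_dichotomies_le[OF VC, of ?A t] z t by (simp add: image_subset_iff)
  also have "\<dots> \<le> (1 / t) ^ d * exp (t * m)"
    using t card_image_le[of "{..<m}" z] by (intro mult_left_mono) auto
  finally show ?thesis .
qed

text \<open>With the labels in \<open>z\<close> fixed, the loss trace is a function of the trace of
  the hypothesis on the first components.\<close>

lemma card_traces_loss:
  "card (traces ((\<lambda>h z. (h (fst z) \<noteq> snd z) = b) ` H) m z) \<le> card (traces H m (\<lambda>i. fst (z i)))"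
proof -
  have "traces ((\<lambda>h z. (h (fst z) \<noteq> snd z) = b) ` H) m z =
      (\<lambda>c. \<lambda>i\<in>{..<m}. (c i \<noteq> snd (z i)) = b) ` traces H m (\<lambda>i. fst (z i))"
    by (auto simp: traces_def image_image restrict_def fun_eq_iff intro!: image_cong)
  then show ?thesis using card_image_le[OF finite_traces] by simp
qed

lemma permissible_hypothesis_class:
  assumes "measurable_hypothesis_class M H" "prob_space P" "sets P = sets M"
  shows "permissible P H"
proof -
  have "space P = space M" using assms(3) by (rule sets_eq_imp_space_eq)
  then show ?thesis
    using assms unfolding permissible_def measurable_hypothesis_class_def space_PiM
    by (auto cong: measurable_cong_sets)
qed

text \<open>The labels are handled by a case distinction over the finitely many label vectors.\<close>

lemma permissible_loss:
  assumes D: "prob_space D" and sets_D: "sets D = sets (M \<Otimes>\<^sub>M count_space (UNIV :: bool set))"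
    and H: "permissible (distr D M fst) H"
  shows "permissible D ((\<lambda>h z. (h (fst z) \<noteq> snd z) = b) ` H)"
  unfolding permissible_def
proof (intro conjI ballI allI)
  have fst_meas: "fst \<in> measurable D M" and snd_meas: "snd \<in> measurable D (count_space UNIV)"
    by (simp_all add: measurable_cong_sets[OF sets_D refl])
  {
    fix g assume "g \<in> (\<lambda>h z. (h (fst z) \<noteq> snd z) = b) ` H"
    then obtain h where h: "h \<in> H" "g = (\<lambda>z. (h (fst z) \<noteq> snd z) = b)" by auto
    have "h \<in> measurable M (count_space UNIV)" using H h(1) by (simp add: permissible_def)
    from measurable_compose[OF fst_meas this] have [measurable]: "(\<lambda>z. h (fst z)) \<in> measurable D (count_space UNIV)" .
    note [measurable] = snd_meas
    show "g \<in> measurable D (count_space UNIV)" unfolding h by measurable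
  }
  fix n :: nat and c
  let ?P = "distr D M fst"
  interpret D: prob_space D by fact
  have P: "prob_space ?P" using fst_meas by (rule D.prob_space_distr)
  let ?PD = "PiM {..<n} (\<lambda>_. D)" and ?PP = "PiM {..<n} (\<lambda>_. ?P)"
  define f :: "(nat \<Rightarrow> 'a \<times> bool) \<Rightarrow> nat \<Rightarrow> 'a" where "f = compose {..<n} fst"
  have "distr ?PD ?PP f = PiM {..<n} (\<lambda>_. distr D ?P fst)"
    unfolding f_def using fst_meas by (intro distr_PiM_finite_prob_space' D P) auto
  also have "distr D ?P fst = ?P" by (rule distr_cong) auto
  finally have distr: "distr ?PD ?PP f = ?PP" .
  have f_meas: "f \<in> measurable ?PD ?PP"
    unfolding f_def compose_def
  proof (intro measurable_restrict)
    fix i assume "i \<in> {..<n}"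
    from measurable_compose[OF measurable_component_singleton[OF this, of "\<lambda>_. D"] fst_meas]
    show "(\<lambda>x. fst (x i)) \<in> measurable ?PD ?P" by simp
  qed
  \<comment> \<open>The pushforward of \<open>?PD\<close> under \<open>f\<close> is exactly
    \<open>?PP\<close>, so null sets pull back to null sets and \<open>f\<close> remains measurable
    between the completions.\<close>
  have f_meas': "f \<in> measurable (completion ?PD) (completion ?PP)"
    using distr by (intro completion.measurable_completion2 measurable_completion f_meas)
      (simp add: distr_completion[OF f_meas])
  let ?T = "\<lambda>c. {x \<in> space ?PP. \<exists>h\<in>H. \<forall>i<n. h (x i) = c i}"
  let ?Y = "\<lambda>y. {z \<in> space ?PD. \<forall>i<n. snd (z i) = y i}"
  have T: "f -` ?T c \<inter> space ?PD \<in> sets (completion ?PD)" for c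
    using measurable_sets[OF f_meas', of "?T c"] H by (simp add: permissible_def)
  have Y: "?Y y \<in> sets (completion ?PD)" for y
  proof -
    have [measurable]: "(\<lambda>z. snd (z i)) \<in> measurable ?PD (count_space UNIV)" if "i \<in> {..<n}" for i
      using measurable_compose[OF measurable_component_singleton[OF that, of "\<lambda>_. D"] snd_meas] by simp
    have "?Y y = {z \<in> space ?PD. \<forall>i\<in>{..<n}. snd (z i) = y i}" by auto
    also have "\<dots> \<in> sets ?PD" by measurable
    finally show ?thesis by simp
  qed
  have "{z \<in> space ?PD. \<exists>g\<in>(\<lambda>h z. (h (fst z) \<noteq> snd z) = b) ` H. \<forall>i<n. g (z i) = c i} =
      (\<Union>y\<in>{..<n} \<rightarrow>\<^sub>E UNIV. ?Y y \<inter> (f -` ?T (\<lambda>i. y i \<noteq> (c i = b)) \<inter> space ?PD))" (is "?L = ?R")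
  proof (intro equalityI subsetI)
    fix z assume "z \<in> ?L"
    then obtain h where h: "z \<in> space ?PD" "h \<in> H" "\<forall>i<n. ((h (fst (z i)) \<noteq> snd (z i)) = b) = c i" by auto
    have "f z \<in> space ?PP" using measurable_space[OF f_meas h(1)] .
    moreover have "\<forall>i<n. h (f z i) = (snd (z i) \<noteq> (c i = b))"
      using h(3) by (auto simp: f_def compose_def)
    ultimately show "z \<in> ?R" using h
      by (intro UN_I[of "\<lambda>i\<in>{..<n}. snd (z i)"]) (auto intro!: bexI[of _ h])
  next
    fix z assume "z \<in> ?R"
    then obtain y where "y \<in> {..<n} \<rightarrow>\<^sub>E (UNIV :: bool set)" "z \<in> ?Y y \<inter> (f -` ?T (\<lambda>i. y i \<noteq> (c i = b)) \<inter> space ?PD)" by (rule UN_E)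
    then have y: "z \<in> ?Y y" "f z \<in> ?T (\<lambda>i. y i \<noteq> (c i = b))" by blast+
    then obtain h where h: "h \<in> H" "\<forall>i<n. h (f z i) = (y i \<noteq> (c i = b))" by auto
    have *: "\<forall>i<n. ((h (fst (z i)) \<noteq> snd (z i)) = b) = c i"
      using y(1) h(2) by (auto simp: f_def compose_def)
    have "(\<lambda>z. (h (fst z) \<noteq> snd z) = b) \<in> (\<lambda>h z. (h (fst z) \<noteq> snd z) = b) ` H" using h(1) by (rule imageI)
    from bexI[where P = "\<lambda>f. \<forall>i<n. f (z i) = c i", OF * this] y(1)
    show "z \<in> ?L" by simp
  qed
  also have "\<dots> \<in> sets (completion ?PD)"
    by (rule sets.finite_UN[OF finite_PiE sets.Int[OF Y T]]) simp_all
  finally show "{z \<in> space ?PD. \<exists>g\<in>(\<lambda>h z. (h (fst z) \<noteq> snd z) = b) ` H. \<forall>i<n. g (z i) = c i}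
     \<in> sets (completion ?PD)" .
qed

section \<open>The exponential mechanism\<close>

lemma prob_le_of_pmf_le:
  assumes "\<And>x. pmf p x \<le> c * pmf q x" "c \<ge> 0"
  shows "measure_pmf.prob p U \<le> c * measure_pmf.prob q U"
proof -
  have "emeasure (measure_pmf p) U = (\<integral>\<^sup>+ x. pmf p x \<partial>count_space U)" by (simp add: nn_integral_pmf)
  also have "\<dots> \<le> (\<integral>\<^sup>+ x. ennreal c * pmf q x \<partial>count_space U)"
    using assms by (intro nn_integral_mono) (simp add: ennreal_mult[symmetric])
  also have "\<dots> = ennreal c * emeasure (measure_pmf q) U" by (simp add: nn_integral_cmult nn_integral_pmf)
  finally show ?thesis using assms(2)
    by (simp add: measure_pmf.emeasure_eq_measure ennreal_mult[symmetric])
qed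

lemma emp_err_neighbour:
  assumes "card {i \<in> {..<n}. S i \<noteq> S' i} = 1"
  shows "emp_err n h S \<le> emp_err n h S' + 1 / n"
proof -
  obtain j where j: "{i \<in> {..<n}. S i \<noteq> S' i} = {j}" using assms by (auto simp: card_1_singleton_iff)
  have "(\<Sum>i<n. of_bool (h (fst (S i)) \<noteq> snd (S i)) :: real) \<le> (\<Sum>i<n. of_bool (h (fst (S' i)) \<noteq> snd (S' i)) + of_bool (i = j))"
  proof (intro sum_mono)
    fix i assume "i \<in> {..<n}"
    then have "i = j \<or> S i = S' i" using j by blast
    then show "of_bool (h (fst (S i)) \<noteq> snd (S i)) \<le> (of_bool (h (fst (S' i)) \<noteq> snd (S' i)) + of_bool (i = j) :: real)"
      by auto
  qed
  also have "\<dots> = (\<Sum>i<n. of_bool (h (fst (S' i)) \<noteq> snd (S' i))) + (\<Sum>i<n. of_bool (i = j))"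
    by (rule sum.distrib)
  also have "(\<Sum>i<n. of_bool (i = j) :: real) = 1"
  proof -
    have "j < n" using j by blast
    then show ?thesis by (simp add: of_bool_def)
  qed
  finally have "1 / n * (\<Sum>i<n. of_bool (h (fst (S i)) \<noteq> snd (S i)))
      \<le> 1 / n * ((\<Sum>i<n. of_bool (h (fst (S' i)) \<noteq> snd (S' i))) + 1)"
    by (rule mult_left_mono) simp
  then show ?thesis by (simp only: emp_err_def distrib_left mult_1_right)
qed

text \<open>The candidate set depends on \<open>T\<close> only, so neighbouring datasets share it.
  Changing one example moves the score by at most \<open>1 / n\<close>; the weight and the
  normalizer then each change by a factor of at most \<open>exp (\<epsilon> / 2)\<close>.\<close>

lemma A_SSPP_private:
  assumes H: "H \<noteq> {}" and \<epsilon>: "\<epsilon> > 0"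
  shows "differentially_private Z n \<epsilon> (\<lambda>S. A_SSPP H rep \<epsilon> n m S T)"
  unfolding differentially_private_def
proof (intro ballI impI allI)
  fix S S' :: "nat \<Rightarrow> 'a \<times> bool" and U
  assume card: "card {i \<in> {..<n}. S i \<noteq> S' i} = 1"
  have card': "card {i \<in> {..<n}. S' i \<noteq> S i} = 1" using card by (simp add: eq_commute)
  \<comment> \<open>Datasets of size 0 have no neighbours, so privacy is vacuous there; this covers
    the sample size chosen in VC dimension zero.\<close>
  have n: "n > 0" using card by (cases n) auto
  let ?R = "representatives H rep m T"
  define w where "w S h = exp (- (\<epsilon> * real n / 2) * emp_err n h S)" for S :: "nat \<Rightarrow> 'a \<times> bool" and h
  have R: "?R \<noteq> {}" "finite ?R"
    using H by (simp add: representatives_def dichotomies_def) (rule finite_representatives)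
  have w_le: "w S h \<le> exp (\<epsilon> / 2) * w S' h" if "card {i \<in> {..<n}. S' i \<noteq> S i} = 1" for S S' h
  proof -
    have "(\<epsilon> * n / 2) * emp_err n h S' \<le> (\<epsilon> * n / 2) * (emp_err n h S + 1 / n)"
      using emp_err_neighbour[OF that, of h] \<epsilon> by (intro mult_left_mono) auto
    also have "\<dots> = (\<epsilon> * n / 2) * emp_err n h S + \<epsilon> / 2" using n by (simp add: field_simps)
    finally show ?thesis by (simp add: w_def exp_add[symmetric])
  qed
  have "pmf (A_SSPP H rep \<epsilon> n m S T) h \<le> exp \<epsilon> * pmf (A_SSPP H rep \<epsilon> n m S' T) h" for h
  proof (cases "h \<in> ?R")
    case True
    have pos: "sum (w S) ?R > 0" for S using R by (intro sum_pos) (auto simp: w_def)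
    have "sum (w S') ?R \<le> exp (\<epsilon> / 2) * sum (w S) ?R"
      unfolding sum_distrib_left by (intro sum_mono w_le card)
    then have "1 / sum (w S) ?R \<le> exp (\<epsilon> / 2) / sum (w S') ?R"
      using pos[of S] pos[of S'] by (simp add: field_simps)
    then have "w S h * (1 / sum (w S) ?R) \<le> (exp (\<epsilon> / 2) * w S' h) * (exp (\<epsilon> / 2) / sum (w S') ?R)"
      using pos[of S] by (intro mult_mono w_le card') (auto simp: w_def less_imp_le)
    also have "\<dots> = exp \<epsilon> * (w S' h / sum (w S') ?R)"
      by (simp add: mult.assoc[symmetric] exp_add[symmetric] mult.commute[of _ "w S' h"])
    finally show ?thesis using True by (simp add: pmf_A_SSPP[OF H] w_def)
  qed (simp add: pmf_A_SSPP[OF H])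
  then show "measure_pmf.prob (A_SSPP H rep \<epsilon> n m S T) U \<le> exp \<epsilon> * measure_pmf.prob (A_SSPP H rep \<epsilon> n m S' T) U"
    by (rule prob_le_of_pmf_le) simp
qed

text \<open>A candidate outside \<open>U\<close> scores worse than \<open>h0\<close> by at least
  \<open>\<tau>\<close>. The normalizer contains the weight of \<open>h0\<close>, so such a
  candidate has probability at most \<open>exp (- (\<epsilon> * n * \<tau> / 2))\<close>; a union
  bound over the candidates finishes.\<close>

lemma A_SSPP_utility:
  assumes H: "H \<noteq> {}" and \<epsilon>: "\<epsilon> > 0" and h0: "h0 \<in> representatives H rep m T"
    and good: "\<And>h. h \<in> representatives H rep m T \<Longrightarrow> emp_err n h S \<le> emp_err n h0 S + \<tau> \<Longrightarrow> h \<in> U"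
  shows "measure_pmf.prob (A_SSPP H rep \<epsilon> n m S T) U
    \<ge> 1 - card (representatives H rep m T) * exp (- (\<epsilon> * n * \<tau> / 2))"
proof -
  let ?R = "representatives H rep m T" and ?A = "A_SSPP H rep \<epsilon> n m S T"
  define w where "w h = exp (- (\<epsilon> * real n / 2) * emp_err n h S)" for h
  note fin = finite_representatives[of H rep m T]
  have supp: "set_pmf ?A \<subseteq> ?R" by (auto simp: set_pmf_iff pmf_A_SSPP[OF H] split: if_splits)
  have "measure_pmf.prob ?A (- U) \<le> measure_pmf.prob ?A (?R - U)"
    using supp by (subst measure_Int_set_pmf[symmetric]) (intro measure_pmf.finite_measure_mono, auto)
  also have "\<dots> = (\<Sum>h\<in>?R - U. pmf ?A h)" using fin by (intro measure_measure_pmf_finite) auto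
  also have "\<dots> \<le> (\<Sum>h\<in>?R - U. exp (- (\<epsilon> * n * \<tau> / 2)))"
  proof (intro sum_mono)
    fix h assume h: "h \<in> ?R - U"
    have "emp_err n h0 S + \<tau> \<le> emp_err n h S" using good[of h] h by force
    then have "(\<epsilon> * n / 2) * (emp_err n h0 S + \<tau>) \<le> (\<epsilon> * n / 2) * emp_err n h S"
      using \<epsilon> by (intro mult_left_mono) auto
    then have "w h \<le> exp (- (\<epsilon> * n * \<tau> / 2)) * w h0" by (simp add: w_def exp_add[symmetric] algebra_simps)
    moreover have "w h0 \<le> sum w ?R" using fin h0 by (intro member_le_sum) (auto simp: w_def)
    moreover have "w h0 > 0" by (simp add: w_def)
    ultimately have "w h / sum w ?R \<le> (exp (- (\<epsilon> * n * \<tau> / 2)) * w h0) / w h0"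
      by (intro frac_le) auto
    also have "\<dots> = exp (- (\<epsilon> * n * \<tau> / 2))" by (simp add: w_def)
    finally show "pmf ?A h \<le> exp (- (\<epsilon> * n * \<tau> / 2))" using h by (simp add: pmf_A_SSPP[OF H] w_def)
  qed
  also have "\<dots> = card (?R - U) * exp (- (\<epsilon> * n * \<tau> / 2))" by simp
  also have "\<dots> \<le> card ?R * exp (- (\<epsilon> * n * \<tau> / 2))"
    using fin by (intro mult_right_mono) (auto intro: card_mono)
  finally show ?thesis using measure_pmf.prob_compl[of U ?A] by (simp add: Compl_eq_Diff_UNIV)
qed

section \<open>Sample sizes\<close>

text \<open>The 128 under \<open>\<alpha>\<close> matches the choice
  \<open>t = \<alpha> / 128\<close> in the count of dichotomies, so that \<open>(1 / t) ^ d\<close>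
  is the exponential of the first term. The 128 under \<open>\<beta>\<close> keeps the sum above 4,
  which provides the minimal sample sizes of the deviation lemmas.\<close>

definition complexity :: "nat \<Rightarrow> real \<Rightarrow> real \<Rightarrow> real" where
  "complexity d \<alpha> \<beta> = real d * ln (128 / \<alpha>) + ln (128 / \<beta>)"

text \<open>
  In VC dimension zero all hypotheses agree on the domain, so no samples are needed; the case is
  separated because the claimed bounds then tend to 0 as \<open>\<beta> \<rightarrow> 1\<close>.
\<close>

definition n_pub :: "nat \<Rightarrow> real \<Rightarrow> real \<Rightarrow> nat" where
  "n_pub d \<alpha> \<beta> = (if d = 0 then 0 else nat \<lceil>64 * complexity d \<alpha> \<beta> / \<alpha>\<rceil>)"

definition n_priv :: "nat \<Rightarrow> real \<Rightarrow> real \<Rightarrow> real \<Rightarrow> nat" where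
  "n_priv d \<alpha> \<beta> \<epsilon> = (if d = 0 then 0 else nat \<lceil>4096 * complexity d \<alpha> \<beta> * max (1 / \<alpha>\<^sup>2) (1 / (\<epsilon> * \<alpha>))\<rceil>)"

lemma ln_128_ge: "ln (128 :: real) \<ge> 4"
proof -
  have "ln (128 :: real) = ln (2 ^ 7)" by simp
  also have "\<dots> = 7 * ln 2" by (subst ln_realpow) auto
  finally show ?thesis using ln2_ge_two_thirds by simp
qed

lemma complexity_ge:
  assumes "0 < \<alpha>" "\<alpha> < 1" "0 < \<beta>" "\<beta> < 1"
  shows "complexity d \<alpha> \<beta> \<ge> real d * ln (128 / \<alpha>)" "complexity d \<alpha> \<beta> \<ge> ln (128 / \<beta>)" "complexity d \<alpha> \<beta> \<ge> 4"
proof -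
  have 1: "ln (128 / \<alpha>) \<ge> 0" using assms by (intro ln_ge_zero) (auto simp: field_simps)
  have "ln \<beta> < 0" using assms by simp
  moreover have "ln (128 / \<beta>) = ln 128 - ln \<beta>" using assms by (simp add: ln_div)
  ultimately have 2: "ln (128 / \<beta>) \<ge> 4" using ln_128_ge by linarith
  show "complexity d \<alpha> \<beta> \<ge> real d * ln (128 / \<alpha>)" "complexity d \<alpha> \<beta> \<ge> ln (128 / \<beta>)" "complexity d \<alpha> \<beta> \<ge> 4"
    using 2 mult_nonneg_nonneg[OF of_nat_0_le_iff[of d] 1] unfolding complexity_def by linarith+
qed

context
  fixes d :: nat and \<alpha> \<beta> :: real
  assumes d: "d > 0" and \<alpha>: "0 < \<alpha>" "\<alpha> < 1" and \<beta>: "0 < \<beta>" "\<beta> < 1"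
begin

text \<open>The upper bound matters as well: the number of representatives, and with it the failure
  of the exponential mechanism, grows with the public sample.\<close>

lemma n_pub_bounds:
  "64 * complexity d \<alpha> \<beta> \<le> n_pub d \<alpha> \<beta> * \<alpha>" "n_pub d \<alpha> \<beta> * \<alpha> \<le> 64 * complexity d \<alpha> \<beta> + 1"
proof -
  have c: "complexity d \<alpha> \<beta> \<ge> 0" using complexity_ge(3)[OF \<alpha> \<beta>, of d] by simp
  have "64 * complexity d \<alpha> \<beta> / \<alpha> \<le> n_pub d \<alpha> \<beta>"
    using d by (simp add: n_pub_def of_nat_ceiling)
  then show "64 * complexity d \<alpha> \<beta> \<le> n_pub d \<alpha> \<beta> * \<alpha>" using \<alpha> by (simp add: field_simps)
  have "real (n_pub d \<alpha> \<beta>) \<le> 64 * complexity d \<alpha> \<beta> / \<alpha> + 1"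
    using d c \<alpha> by (simp add: n_pub_def of_nat_nat ceiling_le_zero)
  then have "n_pub d \<alpha> \<beta> * \<alpha> \<le> (64 * complexity d \<alpha> \<beta> / \<alpha> + 1) * \<alpha>" using \<alpha> by (intro mult_right_mono) auto
  also have "\<dots> = 64 * complexity d \<alpha> \<beta> + \<alpha>" using \<alpha> by (simp add: field_simps)
  finally show "n_pub d \<alpha> \<beta> * \<alpha> \<le> 64 * complexity d \<alpha> \<beta> + 1" using \<alpha> by simp
qed

lemma n_priv_bounds:
  fixes \<epsilon> :: real
  assumes \<epsilon>: "\<epsilon> > 0"
  shows "4096 * complexity d \<alpha> \<beta> \<le> n_priv d \<alpha> \<beta> \<epsilon> * \<alpha>\<^sup>2" "4096 * complexity d \<alpha> \<beta> \<le> \<epsilon> * n_priv d \<alpha> \<beta> \<epsilon> * \<alpha>"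
proof -
  have c: "complexity d \<alpha> \<beta> \<ge> 0" using complexity_ge(3)[OF \<alpha> \<beta>, of d] by simp
  have n: "4096 * complexity d \<alpha> \<beta> * max (1 / \<alpha>\<^sup>2) (1 / (\<epsilon> * \<alpha>)) \<le> n_priv d \<alpha> \<beta> \<epsilon>"
    using d by (simp add: n_priv_def of_nat_ceiling)
  have "4096 * complexity d \<alpha> \<beta> * (1 / \<alpha>\<^sup>2) \<le> n_priv d \<alpha> \<beta> \<epsilon>"
    by (rule order_trans[OF mult_left_mono n]) (use c in auto)
  then show "4096 * complexity d \<alpha> \<beta> \<le> n_priv d \<alpha> \<beta> \<epsilon> * \<alpha>\<^sup>2" using \<alpha> by (simp add: field_simps)
  have "4096 * complexity d \<alpha> \<beta> * (1 / (\<epsilon> * \<alpha>)) \<le> n_priv d \<alpha> \<beta> \<epsilon>"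
    by (rule order_trans[OF mult_left_mono n]) (use c in auto)
  then show "4096 * complexity d \<alpha> \<beta> \<le> \<epsilon> * n_priv d \<alpha> \<beta> \<epsilon> * \<alpha>" using \<alpha> \<epsilon> by (simp add: field_simps)
qed

section \<open>Failure probabilities at the chosen sample sizes\<close>

lemma power_eq_exp_ln: "(128 / \<alpha>) ^ d = exp (d * ln (128 / \<alpha>))"
  using \<alpha> by (subst exp_of_nat_mult) simp

lemma exp_neg_two_ln_le: "2 * exp (- (2 * ln (128 / \<beta>))) \<le> \<beta> / 8"
proof -
  have "exp (- (2 * ln (128 / \<beta>))) = (\<beta> / 128)\<^sup>2"
    using \<beta> by (simp add: exp_minus exp_double field_simps power2_eq_square)
  also have "2 * \<dots> \<le> \<beta> / 8"
    using \<beta> mult_right_mono[of \<beta> 1 \<beta>] by (simp add: power2_eq_square)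
  finally show ?thesis .
qed

lemma public_failure:
  defines "n \<equiv> n_pub d \<alpha> \<beta>"
  shows "2 * (((128 / \<alpha>) ^ d * exp (\<alpha> / 128 * real (2 * n)))\<^sup>2 * 2 powr (- (n * (\<alpha> / 4) / 2))) \<le> \<beta> / 4"
proof -
  have "1 / 2 \<le> ln (2 :: real)" using ln2_ge_two_thirds by simp
  then have "n * (\<alpha> / 4) / 2 * (1 / 2) \<le> n * (\<alpha> / 4) / 2 * ln 2"
    using \<alpha> by (intro mult_left_mono) auto
  then have powr: "(2 :: real) powr (- (n * (\<alpha> / 4) / 2)) \<le> exp (- (n * \<alpha> / 16))"
    unfolding powr_def by simp
  have "2 * (((128 / \<alpha>) ^ d * exp (\<alpha> / 128 * real (2 * n)))\<^sup>2 * 2 powr (- (n * (\<alpha> / 4) / 2)))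
      \<le> 2 * (((128 / \<alpha>) ^ d * exp (\<alpha> / 128 * real (2 * n)))\<^sup>2 * exp (- (n * \<alpha> / 16)))"
    by (intro mult_left_mono powr) auto
  \<comment> \<open>Half of the gain \<open>n * \<alpha> / 16\<close> pays for the exponential part
    of the squared count. The other half is at least
    \<open>2 * complexity d \<alpha> \<beta>\<close>, which cancels the polynomial part and leaves
    \<open>- 2 * ln (128 / \<beta>)\<close>.\<close>
  also have "\<dots> = 2 * exp (2 * (d * ln (128 / \<alpha>)) - n * \<alpha> / 32)"
    unfolding power_eq_exp_ln exp_add[symmetric] exp_double[symmetric] by (simp add: algebra_simps)
  also have "\<dots> \<le> 2 * exp (- (2 * ln (128 / \<beta>)))"
    using n_pub_bounds(1) unfolding n_def by (simp add: complexity_def)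
  also have "\<dots> \<le> \<beta> / 4" using exp_neg_two_ln_le \<beta> by simp
  finally show ?thesis .
qed

lemma private_failure:
  fixes \<epsilon> :: real
  assumes "\<epsilon> > 0"
  defines "n \<equiv> n_priv d \<alpha> \<beta> \<epsilon>"
  shows "2 * ((4096 / \<alpha>\<^sup>2) ^ d * exp (\<alpha>\<^sup>2 / 4096 * real (2 * n)) * exp (- (n * (\<alpha> / 8)\<^sup>2 / 16))) \<le> \<beta> / 8"
proof -
  have "(4096 / \<alpha>\<^sup>2) ^ d \<le> ((128 / \<alpha>)\<^sup>2) ^ d"
    using \<alpha> by (intro power_mono) (auto simp: field_simps)
  also have "\<dots> = exp (2 * (d * ln (128 / \<alpha>)))"
    unfolding exp_double power_eq_exp_ln[symmetric] by (simp add: power_mult[symmetric] mult.commute)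
  finally have "2 * ((4096 / \<alpha>\<^sup>2) ^ d * exp (\<alpha>\<^sup>2 / 4096 * real (2 * n)) * exp (- (n * (\<alpha> / 8)\<^sup>2 / 16)))
      \<le> 2 * (exp (2 * (d * ln (128 / \<alpha>))) * exp (\<alpha>\<^sup>2 / 4096 * real (2 * n)) * exp (- (n * (\<alpha> / 8)\<^sup>2 / 16)))"
    by (intro mult_left_mono mult_right_mono) auto
  \<comment> \<open>The deviation exponent is \<open>n * \<alpha>^2 / 1024\<close>, and
    \<open>t = \<alpha>^2 / 4096\<close> on \<open>2 * n\<close> points takes half of it; the
    remainder is at least \<open>2 * complexity d \<alpha> \<beta>\<close>.\<close>
  also have "\<dots> = 2 * exp (2 * (d * ln (128 / \<alpha>)) - n * \<alpha>\<^sup>2 / 2048)"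
    unfolding exp_add[symmetric] by (simp add: power2_eq_square algebra_simps)
  also have "\<dots> \<le> 2 * exp (- (2 * ln (128 / \<beta>)))"
    using n_priv_bounds(1)[OF assms(1)] unfolding n_def by (simp add: complexity_def)
  also have "\<dots> \<le> \<beta> / 8" by (rule exp_neg_two_ln_le)
  finally show ?thesis .
qed

lemma mechanism_failure:
  fixes \<epsilon> :: real
  assumes "\<epsilon> > 0"
  shows "(128 / \<alpha>) ^ d * exp (\<alpha> / 128 * n_pub d \<alpha> \<beta>) * exp (- (\<epsilon> * n_priv d \<alpha> \<beta> \<epsilon> * (\<alpha> / 8) / 2)) \<le> \<beta> / 4"
proof -
  have "(128 / \<alpha>) ^ d * exp (\<alpha> / 128 * n_pub d \<alpha> \<beta>) * exp (- (\<epsilon> * n_priv d \<alpha> \<beta> \<epsilon> * (\<alpha> / 8) / 2))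
     = exp (d * ln (128 / \<alpha>) + n_pub d \<alpha> \<beta> * \<alpha> / 128 - \<epsilon> * n_priv d \<alpha> \<beta> \<epsilon> * \<alpha> / 16)"
    unfolding power_eq_exp_ln exp_add[symmetric] by (simp add: algebra_simps)
  \<comment> \<open>Writing \<open>c\<close> for the complexity, the positive terms are at most
    \<open>c\<close> and \<open>c / 2 + 1 / 128\<close>, while the subtracted one is at least
    \<open>256 * c\<close>.\<close>
  also have "\<dots> \<le> exp (- ln (128 / \<beta>))"
    using n_pub_bounds(2) n_priv_bounds(2)[OF assms] complexity_ge[OF \<alpha> \<beta>, of d] by simp
  also have "\<dots> \<le> \<beta> / 4" using \<beta> by (simp add: exp_minus)
  finally show ?thesis .
qed

end

section \<open>Accuracy\<close>

lemma err_nonneg: "err h D \<ge> 0"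
  by (simp add: err_def)

text \<open>This is how an unlabelled sample helps with labelled error: a hypothesis can be wrong
  only where the other is wrong or where the two disagree, and disagreement concerns the marginal
  alone.\<close>

lemma err_triangle:
  assumes D: "prob_space D" and sets_D: "sets D = sets (M \<Otimes>\<^sub>M count_space (UNIV :: bool set))"
    and h: "h \<in> measurable M (count_space UNIV)" "h' \<in> measurable M (count_space UNIV)"
  shows "err h' D \<le> err h D + measure (distr D M fst) {x \<in> space (distr D M fst). h x \<noteq> h' x}"
proof -
  interpret D: prob_space D by fact
  have fst_meas: "fst \<in> measurable D M" and [measurable]: "snd \<in> measurable D (count_space UNIV)"
    by (simp_all add: measurable_cong_sets[OF sets_D refl])
  have [measurable]: "(\<lambda>z. h (fst z)) \<in> measurable D (count_space UNIV)" "(\<lambda>z. h' (fst z)) \<in> measurable D (count_space UNIV)"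
    using measurable_compose[OF fst_meas] h by auto
  have "err h' D \<le> measure D ({z \<in> space D. h (fst z) \<noteq> snd z} \<union> {z \<in> space D. h (fst z) \<noteq> h' (fst z)})"
    unfolding err_def by (intro D.finite_measure_mono) auto
  also have "\<dots> \<le> err h D + measure D {z \<in> space D. h (fst z) \<noteq> h' (fst z)}"
    unfolding err_def by (intro measure_Un_le) measurable
  also have "measure D {z \<in> space D. h (fst z) \<noteq> h' (fst z)} =
      measure (distr D M fst) {x \<in> space (distr D M fst). h x \<noteq> h' x}"
  proof -
    have "{x \<in> space M. h x \<noteq> h' x} \<in> sets M" using h by measurable
    then show ?thesis
      using fst_meas by (subst measure_distr) (auto intro!: arg_cong[where f = "measure D"] dest: measurable_space)
  qed
  finally show ?thesis .
qed

lemma representative_of: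
  assumes rep: "representative_rule X H m rep" and T: "T \<in> {..<m} \<rightarrow>\<^sub>E X" and h: "h \<in> H"
  shows "\<exists>h'\<in>representatives H rep m T. h' \<in> H \<and> (\<forall>i<m. h' (T i) = h (T i))"
proof -
  have c: "restrict h (T ` {..<m}) \<in> dichotomies H (T ` {..<m})" using h by (auto simp: dichotomies_def)
  then have "rep T (restrict h (T ` {..<m})) \<in> H"
    "\<forall>x\<in>T ` {..<m}. rep T (restrict h (T ` {..<m})) x = restrict h (T ` {..<m}) x"
    using rep T unfolding representative_rule_def by blast+
  then show ?thesis using c unfolding representatives_def
    by (intro bexI[of _ "rep T (restrict h (T ` {..<m}))"]) auto
qed

lemma representatives_subset:
  assumes "representative_rule X H m rep" "T \<in> {..<m} \<rightarrow>\<^sub>E X"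
  shows "representatives H rep m T \<subseteq> H"
  using assms unfolding representative_rule_def representatives_def by blast

lemma card_representatives_le:
  fixes t :: real
  assumes "VC X H = enat d" "T \<in> {..<m} \<rightarrow>\<^sub>E X" "0 < t" "t \<le> 1"
  shows "real (card (representatives H rep m T)) \<le> (1 / t) ^ d * exp (t * m)"
proof -
  let ?A = "T ` {..<m}"
  have fin: "finite (dichotomies H ?A)" by (intro finite_dichotomies) simp
  have "real (card (representatives H rep m T)) \<le> real (card (dichotomies H ?A))"
    unfolding representatives_def using card_image_le[OF fin] by simp
  also have "\<dots> \<le> (1 / t) ^ d * exp (t * card ?A)"
    using assms by (intro card_dichotomies_le) (auto simp: PiE_iff)
  also have "\<dots> \<le> (1 / t) ^ d * exp (t * m)"
    using assms card_image_le[of "{..<m}" T] by (intro mult_left_mono) auto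
  finally show ?thesis .
qed

text \<open>
  The accuracy event is derived from a deviation bound that holds simultaneously for all of \<open>H\<close>:
  a union bound over the representatives would not do, since they may depend on the public sample
  in a non-measurable way.
\<close>

lemma private_sample_good:
  assumes D: "prob_space D" and sets_D: "sets D = sets (M \<Otimes>\<^sub>M count_space (UNIV :: bool set))"
    and H: "permissible (distr D M fst) H" and VC: "VC (space M) H = enat d"
    and \<alpha>: "0 < \<alpha>" "\<alpha> < 1" and \<beta>: "0 < \<beta>" "\<beta> < 1" and \<epsilon>: "0 < \<epsilon>" and d: "d > 0"
  defines "n \<equiv> n_priv d \<alpha> \<beta> \<epsilon>"
  shows "\<exists>A\<in>sets (PiM {..<n} (\<lambda>_. D)). measure (PiM {..<n} (\<lambda>_. D)) A \<ge> 1 - \<beta> / 4 \<and>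
    (\<forall>S\<in>A. \<forall>h\<in>H. \<bar>emp_err n h S - err h D\<bar> \<le> \<alpha> / 8)"
proof -
  interpret D: prob_space D by fact
  interpret P: prob_space "PiM {..<n} (\<lambda>_. D)" by (rule prob_space_PiM) (rule D)
  have space_D: "space D = space M \<times> UNIV" using sets_eq_imp_space_eq[OF sets_D] by (simp add: space_pair_measure)
  \<comment> \<open>\<open>G True\<close> consists of the losses and \<open>G False\<close> of their
    complements. The one-sided deviation bound on both yields the absolute value, each at a cost of
    \<open>\<beta> / 8\<close>.\<close>
  define G where "G b = (\<lambda>h z. (h (fst z) \<noteq> snd z) = b) ` H" for b
  define K where "K = (4096 / \<alpha>\<^sup>2) ^ d * exp (\<alpha>\<^sup>2 / 4096 * real (2 * n))"
  have \<alpha>2: "\<alpha>\<^sup>2 \<le> 1" using \<alpha> by (simp add: power_le_one)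
  have K: "real (card (traces (G b) (2 * n) z)) \<le> K" if "z \<in> space (PiM {..<2*n} (\<lambda>_. D))" for b z
  proof -
    have "real (card (traces (G b) (2 * n) z)) \<le> real (card (traces H (2 * n) (\<lambda>i. fst (z i))))"
      unfolding G_def using card_traces_loss by (intro of_nat_mono)
    also have "\<dots> \<le> (1 / (\<alpha>\<^sup>2 / 4096)) ^ d * exp (\<alpha>\<^sup>2 / 4096 * real (2 * n))"
      using that \<alpha> \<alpha>2 by (intro card_traces_le[OF VC]) (auto simp: space_PiM PiE_iff space_D mem_Times_iff)
    finally show ?thesis by (simp add: K_def)
  qed
  have n: "n * (\<alpha> / 8)\<^sup>2 \<ge> 8"
    using n_priv_bounds(1)[OF d \<alpha> \<beta> \<epsilon>] complexity_ge(3)[OF \<alpha> \<beta>, of d] unfolding n_def by (simp add: power_divide)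
  have fail: "2 * (K * exp (- (n * (\<alpha> / 8)\<^sup>2 / 16))) \<le> \<beta> / 8"
    using private_failure[OF d \<alpha> \<beta> \<epsilon>] unfolding K_def n_def .
  have "\<exists>A\<in>sets (PiM {..<n} (\<lambda>_. D)). measure (PiM {..<n} (\<lambda>_. D)) A \<ge> 1 - 2 * (K * exp (- (n * (\<alpha> / 8)\<^sup>2 / 16))) \<and>
    (\<forall>x\<in>A. \<forall>g\<in>G b. measure D {z \<in> space D. g z} \<le> 1 / n * (\<Sum>i<n. of_bool (g (x i))) + \<alpha> / 8)" for b
    using \<alpha> n permissible_loss[OF D sets_D H] by (intro uniform_convergence D K) (simp_all add: G_def)
  then have "\<forall>b. \<exists>A. A \<in> sets (PiM {..<n} (\<lambda>_. D)) \<and> measure (PiM {..<n} (\<lambda>_. D)) A \<ge> 1 - 2 * (K * exp (- (n * (\<alpha> / 8)\<^sup>2 / 16))) \<and>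
    (\<forall>x\<in>A. \<forall>g\<in>G b. measure D {z \<in> space D. g z} \<le> 1 / n * (\<Sum>i<n. of_bool (g (x i))) + \<alpha> / 8)"
    unfolding Bex_def by (rule allI)
  from choice[OF this] obtain A where "\<forall>b. A b \<in> sets (PiM {..<n} (\<lambda>_. D)) \<and> measure (PiM {..<n} (\<lambda>_. D)) (A b) \<ge> 1 - 2 * (K * exp (- (n * (\<alpha> / 8)\<^sup>2 / 16))) \<and>
    (\<forall>x\<in>A b. \<forall>g\<in>G b. measure D {z \<in> space D. g z} \<le> 1 / n * (\<Sum>i<n. of_bool (g (x i))) + \<alpha> / 8)" ..
  then have A: "\<And>b. A b \<in> sets (PiM {..<n} (\<lambda>_. D))"
    "\<And>b. measure (PiM {..<n} (\<lambda>_. D)) (A b) \<ge> 1 - 2 * (K * exp (- (n * (\<alpha> / 8)\<^sup>2 / 16)))"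
    "\<And>b x g. x \<in> A b \<Longrightarrow> g \<in> G b \<Longrightarrow> measure D {z \<in> space D. g z} \<le> 1 / n * (\<Sum>i<n. of_bool (g (x i))) + \<alpha> / 8"
    by auto
  \<comment> \<open>Complementing the empirical error needs a genuine average: division by zero
    would make the empirical error of a class and of its complement both 0.\<close>
  have n0: "n > 0" using n by (cases n) auto
  define B where "B = A True \<inter> A False"
  have B: "B \<in> sets (PiM {..<n} (\<lambda>_. D))" unfolding B_def by (rule sets.Int[OF A(1) A(1)])
  have "P.prob B \<ge> 1 - \<beta> / 4"
  proof -
    let ?C = "\<lambda>b. space (PiM {..<n} (\<lambda>_. D)) - A b"
    have compl: "P.prob (?C b) \<le> \<beta> / 8" for b
      using A(2)[of b] fail P.prob_compl[OF A(1)[of b]] by linarith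
    have "space (PiM {..<n} (\<lambda>_. D)) - B = ?C True \<union> ?C False" unfolding B_def by (rule Diff_Int)
    also have "P.prob \<dots> \<le> P.prob (?C True) + P.prob (?C False)"
      by (rule measure_Un_le[OF sets.compl_sets[OF A(1)] sets.compl_sets[OF A(1)]])
    finally show ?thesis using compl[of True] compl[of False] P.prob_compl[OF B] by linarith
  qed
  moreover have "\<bar>emp_err n h S - err h D\<bar> \<le> \<alpha> / 8" if S: "S \<in> B" and h: "h \<in> H" for S h
  proof -
    have "(\<lambda>z. (h (fst z) \<noteq> snd z) = b) \<in> G b" for b using h unfolding G_def by (rule imageI)
    note dev = A(3)[OF _ this]
    have "measure D {z \<in> space D. (h (fst z) \<noteq> snd z) = True} = err h D"
      "1 / n * (\<Sum>i<n. of_bool ((h (fst (S i)) \<noteq> snd (S i)) = True)) = emp_err n h S"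
      by (simp_all add: err_def emp_err_def)
    then have 1: "err h D \<le> emp_err n h S + \<alpha> / 8"
      using dev[of S True] S unfolding B_def by (metis IntD1)
    have "(\<lambda>z. (h (fst z) \<noteq> snd z) = True) \<in> measurable D (count_space UNIV)"
      using permissible_loss[OF D sets_D H, of True] h unfolding permissible_def by blast
    then have E: "{z \<in> space D. h (fst z) \<noteq> snd z} \<in> sets D" by (simp add: pred_def)
    have "{z \<in> space D. (h (fst z) \<noteq> snd z) = False} = space D - {z \<in> space D. h (fst z) \<noteq> snd z}" by blast
    then have "measure D {z \<in> space D. (h (fst z) \<noteq> snd z) = False} = 1 - err h D"
      using D.prob_compl[OF E] unfolding err_def by simp
    moreover have "(\<Sum>i<n. of_bool ((h (fst (S i)) \<noteq> snd (S i)) = False)) =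
        (\<Sum>i<n. 1 - of_bool (h (fst (S i)) \<noteq> snd (S i)) :: real)"
      by (intro sum.cong) auto
    then have "1 / n * (\<Sum>i<n. of_bool ((h (fst (S i)) \<noteq> snd (S i)) = False)) = 1 - emp_err n h S"
      using n0 by (simp add: sum_subtractf emp_err_def right_diff_distrib del: sum_of_bool_eq)
    ultimately have "1 - err h D \<le> 1 - emp_err n h S + \<alpha> / 8"
      using dev[of S False] S unfolding B_def by (metis IntD2)
    then show ?thesis using 1 by linarith
  qed
  ultimately show ?thesis by (intro bexI[OF _ B] conjI ballI)
qed

lemma public_sample_good:
  assumes P: "prob_space P" and H: "permissible P H" and VC: "VC (space P) H = enat d"
    and \<alpha>: "0 < \<alpha>" "\<alpha> < 1" and \<beta>: "0 < \<beta>" "\<beta> < 1" and d: "d > 0"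
  defines "n \<equiv> n_pub d \<alpha> \<beta>"
  shows "\<exists>A\<in>sets (PiM {..<n} (\<lambda>_. P)). measure (PiM {..<n} (\<lambda>_. P)) A \<ge> 1 - \<beta> / 4 \<and>
    (\<forall>T\<in>A. \<forall>h\<in>H. \<forall>h'\<in>H. (\<forall>i<n. h (T i) = h' (T i)) \<longrightarrow> measure P {x \<in> space P. h x \<noteq> h' x} \<le> \<alpha> / 4)"
proof -
  define G where "G = (\<lambda>(g, g') z. g z \<noteq> g' z) ` (H \<times> H)"
  \<comment> \<open>The count for \<open>t = \<alpha> / 128\<close> on the doubled sample, squared
    because disagreement regions come from pairs.\<close>
  define K where "K = ((128 / \<alpha>) ^ d * exp (\<alpha> / 128 * real (2 * n)))\<^sup>2"
  have K: "real (card (traces G (2 * n) z)) \<le> K" if "z \<in> space (PiM {..<2*n} (\<lambda>_. P))" for z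
  proof -
    have "real (card (traces G (2 * n) z)) \<le> (real (card (traces H (2 * n) z)))\<^sup>2"
      unfolding G_def of_nat_power[symmetric] using card_traces_disagreement by (intro of_nat_mono)
    also have "\<dots> \<le> ((1 / (\<alpha> / 128)) ^ d * exp (\<alpha> / 128 * real (2 * n)))\<^sup>2"
    proof (intro power_mono card_traces_le[OF VC])
      show "z i \<in> space P" if "i < 2 * n" for i
        using that \<open>z \<in> space (PiM {..<2*n} (\<lambda>_. P))\<close> by (auto simp: space_PiM PiE_iff)
    qed (use \<alpha> in auto)
    finally show ?thesis by (simp add: K_def)
  qed
  have n: "n * (\<alpha> / 4) \<ge> 8"
    using n_pub_bounds(1)[OF d \<alpha> \<beta>] complexity_ge(3)[OF \<alpha> \<beta>, of d] unfolding n_def by simp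
  have fail: "2 * (K * 2 powr (- (n * (\<alpha> / 4) / 2))) \<le> \<beta> / 4"
    using public_failure[OF d \<alpha> \<beta>] unfolding K_def n_def .
  have "\<exists>A\<in>sets (PiM {..<n} (\<lambda>_. P)). measure (PiM {..<n} (\<lambda>_. P)) A \<ge> 1 - 2 * (K * 2 powr (- (n * (\<alpha> / 4) / 2))) \<and>
    (\<forall>x\<in>A. \<forall>g\<in>G. (\<forall>i<n. \<not> g (x i)) \<longrightarrow> measure P {z \<in> space P. g z} \<le> \<alpha> / 4)"
    using \<alpha> n permissible_disagreement[OF H] by (intro epsilon_net P K) (simp_all add: G_def)
  then obtain A where A: "A \<in> sets (PiM {..<n} (\<lambda>_. P))"
    "measure (PiM {..<n} (\<lambda>_. P)) A \<ge> 1 - 2 * (K * 2 powr (- (n * (\<alpha> / 4) / 2)))"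
    "\<And>x g. x \<in> A \<Longrightarrow> g \<in> G \<Longrightarrow> (\<forall>i<n. \<not> g (x i)) \<Longrightarrow> measure P {z \<in> space P. g z} \<le> \<alpha> / 4"
    by blast
  show ?thesis
  proof (intro bexI[OF _ A(1)] conjI ballI impI)
    show "measure (PiM {..<n} (\<lambda>_. P)) A \<ge> 1 - \<beta> / 4" using A(2) fail by linarith
    fix T h h' assume T: "T \<in> A" "h \<in> H" "h' \<in> H" "\<forall>i<n. h (T i) = h' (T i)"
    have "(\<lambda>x. h x \<noteq> h' x) \<in> G"
      unfolding G_def using T by (intro image_eqI[of _ _ "(h, h')"]) simp_all
    from A(3)[OF T(1) this] T(4) show "measure P {x \<in> space P. h x \<noteq> h' x} \<le> \<alpha> / 4" by simp
  qed
qed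

lemma A_SSPP_accurate:
  fixes M :: "'x measure" and \<alpha> \<beta> \<epsilon> :: real
  assumes H: "measurable_hypothesis_class M H" "H \<noteq> {}" and VC: "VC (space M) H = enat d"
    and \<alpha>: "0 < \<alpha>" "\<alpha> < 1" and \<beta>: "0 < \<beta>" "\<beta> < 1" and \<epsilon>: "0 < \<epsilon>" and d: "d > 0"
    and rep: "representative_rule (space M) H (n_pub d \<alpha> \<beta>) rep"
    and D: "prob_space D" and sets_D: "sets D = sets (M \<Otimes>\<^sub>M count_space UNIV)"
  defines "m \<equiv> n_pub d \<alpha> \<beta>" and "n \<equiv> n_priv d \<alpha> \<beta> \<epsilon>"
  shows "ennreal (1 - \<beta>) \<le> (\<integral>\<^sup>+ (S, T). ennreal (measure_pmf.prob (A_SSPP H rep \<epsilon> n m S T)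
             {h. err h D \<le> (INF h'\<in>H. err h' D) + \<alpha>})
           \<partial>(Pi\<^sub>M {..<n} (\<lambda>_. D) \<Otimes>\<^sub>M Pi\<^sub>M {..<m} (\<lambda>_. distr D M fst)))"
proof -
  interpret D: prob_space D by fact
  let ?P = "distr D M fst"
  have "fst \<in> measurable D M" by (simp add: measurable_cong_sets[OF sets_D refl])
  then have P: "prob_space ?P" by (rule D.prob_space_distr)
  have perm: "permissible ?P H" using H(1) P by (rule permissible_hypothesis_class) simp
  have VC': "VC (space ?P) H = enat d" using VC by simp
  have meas: "h \<in> measurable M (count_space UNIV)" if "h \<in> H" for h
    using H(1) that by (simp add: measurable_hypothesis_class_def)
  interpret PS: prob_space "PiM {..<n} (\<lambda>_. D)" by (rule prob_space_PiM) (rule D)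
  interpret PT: prob_space "PiM {..<m} (\<lambda>_. ?P)" by (rule prob_space_PiM) (rule P)
  obtain A where A: "A \<in> sets (PiM {..<n} (\<lambda>_. D))" "PS.prob A \<ge> 1 - \<beta> / 4"
    "\<And>S h. S \<in> A \<Longrightarrow> h \<in> H \<Longrightarrow> \<bar>emp_err n h S - err h D\<bar> \<le> \<alpha> / 8"
    using private_sample_good[OF D sets_D perm VC \<alpha> \<beta> \<epsilon> d] unfolding n_def by blast
  from public_sample_good[OF P perm VC' \<alpha> \<beta> d, folded m_def]
  obtain B where B1: "B \<in> sets (PiM {..<m} (\<lambda>_. ?P))" and B2: "PT.prob B \<ge> 1 - \<beta> / 4 \<and>
    (\<forall>T\<in>B. \<forall>h\<in>H. \<forall>h'\<in>H. (\<forall>i<m. h (T i) = h' (T i)) \<longrightarrow> measure ?P {x \<in> space ?P. h x \<noteq> h' x} \<le> \<alpha> / 4)"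
    by (rule bexE)
  note B = B1 B2[THEN conjunct1] B2[THEN conjunct2, rule_format]
  let ?U = "{h. err h D \<le> (INF h'\<in>H. err h' D) + \<alpha>}"
  have bdd: "bdd_below ((\<lambda>h. err h D) ` H)" by (rule bdd_belowI[of _ 0]) (auto simp: err_nonneg)
  \<comment> \<open>The infimum need not be attained, so the comparator is only
    \<open>\<alpha> / 8\<close>-optimal.\<close>
  obtain h1 where h1: "h1 \<in> H" "err h1 D < (INF h'\<in>H. err h' D) + \<alpha> / 8"
    using cINF_less_iff[OF H(2) bdd, of "(INF h'\<in>H. err h' D) + \<alpha> / 8"] \<alpha> by auto
  have good: "measure_pmf.prob (A_SSPP H rep \<epsilon> n m S T) ?U \<ge> 1 - \<beta> / 4" if S: "S \<in> A" and T: "T \<in> B" for S T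
  proof -
    have T': "T \<in> {..<m} \<rightarrow>\<^sub>E space M"
      using sets.sets_into_space[OF B(1)] T by (auto simp: space_PiM)
    obtain h0 where h0: "h0 \<in> representatives H rep m T" "h0 \<in> H" "\<forall>i<m. h0 (T i) = h1 (T i)"
      using representative_of[OF rep[folded m_def] T' h1(1)] by blast
    have "err h0 D \<le> err h1 D + measure ?P {x \<in> space ?P. h1 x \<noteq> h0 x}"
      by (rule err_triangle[OF D sets_D meas[OF h1(1)] meas[OF h0(2)]])
    also have "measure ?P {x \<in> space ?P. h1 x \<noteq> h0 x} \<le> \<alpha> / 4"
      using h0(3) by (intro B(3)[OF T h1(1) h0(2)]) simp
    finally have h0_err: "err h0 D \<le> (INF h'\<in>H. err h' D) + \<alpha> / 8 + \<alpha> / 4" using h1(2) by linarith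
    have "1 - card (representatives H rep m T) * exp (- (\<epsilon> * n * (\<alpha> / 8) / 2))
        \<le> measure_pmf.prob (A_SSPP H rep \<epsilon> n m S T) ?U"
    proof (rule A_SSPP_utility[OF H(2) \<epsilon> h0(1)])
      fix h assume h: "h \<in> representatives H rep m T" "emp_err n h S \<le> emp_err n h0 S + \<alpha> / 8"
      have "h \<in> H" using representatives_subset[OF rep[folded m_def] T'] h(1) by blast
      \<comment> \<open>Error budget: \<open>3 * \<alpha> / 8\<close> in \<open>h0_err\<close>,
        \<open>\<alpha> / 8\<close> for each of the two passages between empirical and true error,
        and \<open>\<alpha> / 8\<close> for the slack of the mechanism;
        \<open>3 * \<alpha> / 4\<close> in total.\<close>
      from A(3)[OF S this] A(3)[OF S h0(2)] h(2) h0_err \<alpha> show "h \<in> ?U"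
        unfolding mem_Collect_eq by linarith
    qed
    moreover have "card (representatives H rep m T) * exp (- (\<epsilon> * n * (\<alpha> / 8) / 2)) \<le> \<beta> / 4"
    proof -
      have "real (card (representatives H rep m T)) \<le> (1 / (\<alpha> / 128)) ^ d * exp (\<alpha> / 128 * m)"
        using \<alpha> by (intro card_representatives_le[OF VC T']) auto
      then have "card (representatives H rep m T) * exp (- (\<epsilon> * n * (\<alpha> / 8) / 2))
          \<le> (1 / (\<alpha> / 128)) ^ d * exp (\<alpha> / 128 * m) * exp (- (\<epsilon> * n * (\<alpha> / 8) / 2))"
        by (rule mult_right_mono) simp
      also have "\<dots> \<le> \<beta> / 4" using mechanism_failure[OF d \<alpha> \<beta> \<epsilon>] unfolding m_def n_def by simp
      finally show ?thesis .
    qed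
    ultimately show ?thesis by linarith
  qed
  let ?M = "PiM {..<n} (\<lambda>_. D) \<Otimes>\<^sub>M PiM {..<m} (\<lambda>_. ?P)"
  have AB: "A \<times> B \<in> sets ?M" using A(1) B(1) by auto
  \<comment> \<open>Three factors for three sources of failure, each at most
    \<open>\<beta> / 4\<close>: the private sample, the public sample and the coins.\<close>
  have "1 - \<beta> \<le> (1 - \<beta> / 4) * ((1 - \<beta> / 4) * (1 - \<beta> / 4))"
  proof -
    have "1 - \<beta> \<le> 1 - 3 * \<beta> / 4" using \<beta> by simp
    also have "\<dots> \<le> 1 - 3 * \<beta> / 4 + \<beta>\<^sup>2 * (3 / 16 - \<beta> / 64)"
      using \<beta> by (simp add: mult_nonneg_nonneg)
    also have "\<dots> = (1 - \<beta> / 4) * ((1 - \<beta> / 4) * (1 - \<beta> / 4))"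
      by (simp add: field_simps power2_eq_square)
    finally show ?thesis .
  qed
  also have "\<dots> \<le> (1 - \<beta> / 4) * (PS.prob A * PT.prob B)"
    using A(2) B(2) \<beta> by (intro mult_left_mono mult_mono) auto
  finally have "ennreal (1 - \<beta>) \<le> ennreal ((1 - \<beta> / 4) * (PS.prob A * PT.prob B))" by (rule ennreal_leI)
  also have "\<dots> = ennreal (1 - \<beta> / 4) * emeasure ?M (A \<times> B)"
    using A(1) B(1) \<beta> by (simp add: PT.emeasure_pair_measure_Times PS.emeasure_eq_measure PT.emeasure_eq_measure ennreal_mult)
  also have "\<dots> = (\<integral>\<^sup>+ x. ennreal (1 - \<beta> / 4) * indicator (A \<times> B) x \<partial>?M)"
    using AB by (simp add: nn_integral_cmult_indicator)
  \<comment> \<open>The success probability need not be measurable in \<open>(S, T)\<close>, but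
    monotonicity of the lower integral needs only the measurable minorant supported on
    \<open>A \<times> B\<close>.\<close>
  also have "\<dots> \<le> (\<integral>\<^sup>+ (S, T). ennreal (measure_pmf.prob (A_SSPP H rep \<epsilon> n m S T) ?U) \<partial>?M)"
  proof (intro nn_integral_mono)
    fix x assume "x \<in> space ?M"
    obtain S T where x: "x = (S, T)" by (cases x)
    show "ennreal (1 - \<beta> / 4) * indicator (A \<times> B) x \<le>
        (case x of (S, T) \<Rightarrow> ennreal (measure_pmf.prob (A_SSPP H rep \<epsilon> n m S T) ?U))"
      using good[of S T] unfolding x by (auto simp: indicator_def intro!: ennreal_leI)
  qed
  finally show ?thesis .
qed

section \<open>VC dimension zero and the learner property\<close>

text \<open>A point of the domain where two hypotheses differ would be a shattered
  singleton.\<close>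

lemma err_eq_of_VC_0:
  assumes VC: "VC (space M) H = enat 0" and sets_D: "sets D = sets (M \<Otimes>\<^sub>M count_space (UNIV :: bool set))"
    and h: "h \<in> H" "h' \<in> H"
  shows "err h D = err h' D"
proof -
  have agree: "h x = h' x" if x: "x \<in> space M" for x
  proof (rule ccontr)
    assume "h x \<noteq> h' x"
    then have "shatters H {x}" unfolding shatters_iff using h by (metis (full_types) singletonD)
    then have "enat (card {x}) \<le> VC (space M) H"
      unfolding VC_def using x by (intro SUP_upper) auto
    then show False using VC by simp
  qed
  have "space D = space M \<times> UNIV" using sets_eq_imp_space_eq[OF sets_D] by (simp add: space_pair_measure)
  then have "{z \<in> space D. h (fst z) \<noteq> snd z} = {z \<in> space D. h' (fst z) \<noteq> snd z}"
    using agree by (auto simp: mem_Times_iff)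
  then show ?thesis by (simp add: err_def)
qed

lemma A_SSPP_accurate_VC_0:
  fixes M :: "'x measure" and \<alpha> \<epsilon> :: real
  assumes H: "H \<noteq> {}" and VC: "VC (space M) H = enat 0" and \<alpha>: "0 < \<alpha>"
    and rep: "representative_rule (space M) H m rep"
    and D: "prob_space D" and sets_D: "sets D = sets (M \<Otimes>\<^sub>M count_space UNIV)"
  shows "(\<integral>\<^sup>+ (S, T). ennreal (measure_pmf.prob (A_SSPP H rep \<epsilon> n m S T)
             {h. err h D \<le> (INF h'\<in>H. err h' D) + \<alpha>})
           \<partial>(Pi\<^sub>M {..<n} (\<lambda>_. D) \<Otimes>\<^sub>M Pi\<^sub>M {..<m} (\<lambda>_. distr D M fst))) = 1"
proof -
  interpret D: prob_space D by fact
  let ?P = "distr D M fst"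
  have "fst \<in> measurable D M" by (simp add: measurable_cong_sets[OF sets_D refl])
  then have P: "prob_space ?P" by (rule D.prob_space_distr)
  interpret PS: prob_space "PiM {..<n} (\<lambda>_. D)" by (rule prob_space_PiM) (rule D)
  interpret PT: prob_space "PiM {..<m} (\<lambda>_. ?P)" by (rule prob_space_PiM) (rule P)
  interpret PP: pair_prob_space "PiM {..<n} (\<lambda>_. D)" "PiM {..<m} (\<lambda>_. ?P)" ..
  have good: "h \<in> {h. err h D \<le> (INF h'\<in>H. err h' D) + \<alpha>}" if "h \<in> H" for h
  proof -
    have "(\<lambda>h'. err h' D) ` H = (\<lambda>_. err h D) ` H"
      by (rule image_cong[OF refl]) (rule err_eq_of_VC_0[OF VC sets_D _ that])
    then show ?thesis using \<alpha> H by simp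
  qed
  have "measure_pmf.prob (A_SSPP H rep \<epsilon> n m S T) {h. err h D \<le> (INF h'\<in>H. err h' D) + \<alpha>} = 1"
    if T: "T \<in> {..<m} \<rightarrow>\<^sub>E space M" for S T
  proof -
    have "set_pmf (A_SSPP H rep \<epsilon> n m S T) \<subseteq> representatives H rep m T"
      by (auto simp: set_pmf_iff pmf_A_SSPP[OF H] split: if_splits)
    also have "\<dots> \<subseteq> H" by (rule representatives_subset[OF rep T])
    finally show ?thesis using good
      by (subst measure_pmf.prob_eq_1) (auto intro!: AE_pmfI)
  qed
  then have "(\<integral>\<^sup>+ (S, T). ennreal (measure_pmf.prob (A_SSPP H rep \<epsilon> n m S T)
      {h. err h D \<le> (INF h'\<in>H. err h' D) + \<alpha>}) \<partial>(Pi\<^sub>M {..<n} (\<lambda>_. D) \<Otimes>\<^sub>M Pi\<^sub>M {..<m} (\<lambda>_. ?P)))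
    = (\<integral>\<^sup>+ x. 1 \<partial>(Pi\<^sub>M {..<n} (\<lambda>_. D) \<Otimes>\<^sub>M Pi\<^sub>M {..<m} (\<lambda>_. ?P)))"
    by (intro nn_integral_cong) (auto simp: space_pair_measure space_PiM)
  also have "\<dots> = 1" by (simp add: PP.emeasure_space_1)
  finally show ?thesis .
qed

lemma A_SSPP_semi_private_learner:
  assumes "measurable_hypothesis_class M H" "H \<noteq> {}" "VC (space M) H = enat d"
    "0 < \<alpha>" "\<alpha> < 1" "0 < \<beta>" "\<beta> < 1" "0 < \<epsilon>"
    "representative_rule (space M) H (n_pub d \<alpha> \<beta>) rep"
  shows "semi_private_learner M H \<alpha> \<beta> \<epsilon> (n_priv d \<alpha> \<beta> \<epsilon>) (n_pub d \<alpha> \<beta>)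
    (A_SSPP H rep \<epsilon> (n_priv d \<alpha> \<beta> \<epsilon>) (n_pub d \<alpha> \<beta>))"
  unfolding semi_private_learner_def
proof (intro conjI allI impI ballI; (elim conjE)?)
  show "differentially_private (space M \<times> UNIV) (n_priv d \<alpha> \<beta> \<epsilon>) \<epsilon>
     (\<lambda>S. A_SSPP H rep \<epsilon> (n_priv d \<alpha> \<beta> \<epsilon>) (n_pub d \<alpha> \<beta>) S T)" for T
    using assms by (intro A_SSPP_private)
  fix D :: "('a \<times> bool) measure"
  assume D: "prob_space D" "sets D = sets (M \<Otimes>\<^sub>M count_space UNIV)"
  show "ennreal (1 - \<beta>) \<le> (\<integral>\<^sup>+ (S, T). ennreal (measure_pmf.prob
        (A_SSPP H rep \<epsilon> (n_priv d \<alpha> \<beta> \<epsilon>) (n_pub d \<alpha> \<beta>) S T)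
             {h. err h D \<le> (INF h'\<in>H. err h' D) + \<alpha>})
           \<partial>(Pi\<^sub>M {..<n_priv d \<alpha> \<beta> \<epsilon>} (\<lambda>_. D) \<Otimes>\<^sub>M Pi\<^sub>M {..<n_pub d \<alpha> \<beta>} (\<lambda>_. distr D M fst)))"
  proof (cases "d = 0")
    case True
    show ?thesis
      using A_SSPP_accurate_VC_0[OF assms(2) _ assms(4) assms(9) D] assms True by simp
  next
    case False
    then show ?thesis using A_SSPP_accurate[OF assms(1-8) _ assms(9) D] by simp
  qed
qed

section \<open>Asymptotic bounds on the sample sizes\<close>

text \<open>The constants inside the logarithms add \<open>(d + 1) * ln 128\<close>. Since
  \<open>\<alpha>\<close> stays below \<open>\<alpha>0\<close>, the claimed bound is at least
  \<open>d * ln (1 / \<alpha>0)\<close>, which absorbs this sum up to a factor depending on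
  \<open>\<alpha>0\<close> only.\<close>

lemma complexity_le:
  fixes \<alpha>0 :: real
  assumes \<alpha>0: "0 < \<alpha>0" "\<alpha>0 < 1" and \<alpha>: "0 < \<alpha>" "\<alpha> \<le> \<alpha>0" and \<beta>: "0 < \<beta>" "\<beta> < 1" and d: "d > 0"
  defines "B \<equiv> real d * ln (1 / \<alpha>) + ln (1 / \<beta>)"
  shows "complexity d \<alpha> \<beta> \<le> (1 + 2 * ln 128 / ln (1 / \<alpha>0)) * B"
proof -
  define l where "l = ln (1 / \<alpha>0)"
  have l: "l > 0" using \<alpha>0 by (simp add: l_def)
  have "l \<le> ln (1 / \<alpha>)" unfolding l_def using \<alpha>0 \<alpha> by (simp add: frac_le)
  then have "d * l \<le> d * ln (1 / \<alpha>)" by (intro mult_left_mono) auto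
  also have "\<dots> \<le> B" using \<beta> by (simp add: B_def)
  finally have dl: "d * l \<le> B" .
  have "complexity d \<alpha> \<beta> = B + (d + 1) * ln 128"
    using \<alpha> \<beta> by (simp add: complexity_def B_def ln_div algebra_simps)
  \<comment> \<open>Here \<open>d + 1 \<le> 2 * d\<close> fails for \<open>d = 0\<close>: the term
    \<open>ln 128\<close> could not be absorbed, since the claimed bound would tend to 0 as
    \<open>\<beta>\<close> tends to 1.\<close>
  also have "(d + 1) * ln 128 \<le> (2 * d) * ln (128 :: real)"
    using d by (intro mult_right_mono) auto
  also have "\<dots> = 2 * ln 128 / l * (d * l)" using l by simp
  also have "\<dots> \<le> 2 * ln 128 / l * B" using l dl by (intro mult_left_mono) auto
  finally show ?thesis by (simp add: l_def algebra_simps)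
qed

lemma nat_ceiling_le_double:
  assumes "(x :: real) \<ge> 1"
  shows "real (nat \<lceil>x\<rceil>) \<le> 2 * x"
proof -
  have "real (nat \<lceil>x\<rceil>) = of_int \<lceil>x\<rceil>" using assms by simp
  also have "\<dots> \<le> x + 1" by (rule of_int_ceiling_le_add_one)
  finally show ?thesis using assms by linarith
qed

lemma n_pub_le:
  fixes \<alpha>0 :: real
  assumes "0 < \<alpha>0" "\<alpha>0 < 1" "0 < \<alpha>" "\<alpha> \<le> \<alpha>0" "0 < \<beta>" "\<beta> < 1"
  shows "real (n_pub d \<alpha> \<beta>) \<le> 128 * (1 + 2 * ln 128 / ln (1 / \<alpha>0)) *
     ((real d * ln (1 / \<alpha>) + ln (1 / \<beta>)) / \<alpha>)"
proof (cases "d = 0")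
  case True
  then show ?thesis using assms by (simp add: n_pub_def)
next
  case False
  have \<alpha>: "0 < \<alpha>" "\<alpha> < 1" using assms by auto
  define B where "B = real d * ln (1 / \<alpha>) + ln (1 / \<beta>)"
  define c where "c = 1 + 2 * ln 128 / ln (1 / \<alpha>0)"
  \<comment> \<open>The quantity under the ceiling is at least 1, so rounding up at most doubles
    it.\<close>
  have "1 * 1 \<le> 64 * complexity d \<alpha> \<beta> * (1 / \<alpha>)"
    using complexity_ge(3)[OF \<alpha> assms(5,6), of d] \<alpha> by (intro mult_mono) auto
  then have "real (n_pub d \<alpha> \<beta>) \<le> 2 * (64 * complexity d \<alpha> \<beta> / \<alpha>)"
    using False unfolding n_pub_def by (simp only: if_False) (rule nat_ceiling_le_double, simp)
  also have "\<dots> = 128 / \<alpha> * complexity d \<alpha> \<beta>" by simp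
  also have "\<dots> \<le> 128 / \<alpha> * (c * B)"
    unfolding c_def B_def using False assms by (intro mult_left_mono complexity_le) auto
  also have "\<dots> = 128 * c * (B / \<alpha>)" by simp
  finally show ?thesis by (simp only: B_def c_def)
qed

lemma n_priv_le:
  fixes \<alpha>0 :: real
  assumes "0 < \<alpha>0" "\<alpha>0 < 1" "0 < \<alpha>" "\<alpha> \<le> \<alpha>0" "0 < \<beta>" "\<beta> < 1" "0 < \<epsilon>"
  shows "real (n_priv d \<alpha> \<beta> \<epsilon>) \<le> 8192 * (1 + 2 * ln 128 / ln (1 / \<alpha>0)) *
     ((real d * ln (1 / \<alpha>) + ln (1 / \<beta>)) * max (1 / \<alpha>\<^sup>2) (1 / (\<epsilon> * \<alpha>)))"
proof (cases "d = 0")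
  case True
  then show ?thesis using assms by (simp add: n_priv_def le_max_iff_disj)
next
  case False
  have \<alpha>: "0 < \<alpha>" "\<alpha> < 1" using assms by auto
  define B where "B = real d * ln (1 / \<alpha>) + ln (1 / \<beta>)"
  define c where "c = 1 + 2 * ln 128 / ln (1 / \<alpha>0)"
  define mx where "mx = max (1 / \<alpha>\<^sup>2) (1 / (\<epsilon> * \<alpha>))"
  have "1 \<le> 1 / \<alpha>\<^sup>2" using \<alpha> by (simp add: power_le_one)
  then have mx: "mx \<ge> 1" by (simp add: mx_def)
  have "1 * 1 \<le> 4096 * complexity d \<alpha> \<beta> * mx"
    using complexity_ge(3)[OF \<alpha> assms(5,6), of d] mx by (intro mult_mono) auto
  then have "real (n_priv d \<alpha> \<beta> \<epsilon>) \<le> 2 * (4096 * complexity d \<alpha> \<beta> * mx)"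
    using False unfolding n_priv_def mx_def by (simp only: if_False) (rule nat_ceiling_le_double, simp)
  also have "\<dots> = 8192 * mx * complexity d \<alpha> \<beta>" by simp
  also have "\<dots> \<le> 8192 * mx * (c * B)"
    unfolding c_def B_def using False assms mx by (intro mult_left_mono complexity_le) auto
  also have "\<dots> = 8192 * c * (B * mx)" by simp
  finally show ?thesis by (simp only: B_def c_def mx_def)
qed

theorem theorem3p1:
  "\<exists>(n_priv :: nat \<Rightarrow> real \<Rightarrow> real \<Rightarrow> real \<Rightarrow> nat) (n_pub :: nat \<Rightarrow> real \<Rightarrow> real \<Rightarrow> nat).
     (\<forall>(M :: 'x measure) (H :: ('x \<Rightarrow> bool) set) (d :: nat) (\<alpha> :: real) (\<beta> :: real) (\<epsilon> :: real) rep.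
        measurable_hypothesis_class M H \<and> H \<noteq> {} \<and> VC (space M) H = enat d \<and>
        0 < \<alpha> \<and> \<alpha> < 1 \<and> 0 < \<beta> \<and> \<beta> < 1 \<and> 0 < \<epsilon> \<and>
        representative_rule (space M) H (n_pub d \<alpha> \<beta>) rep
        \<longrightarrow> semi_private_learner M H \<alpha> \<beta> \<epsilon> (n_priv d \<alpha> \<beta> \<epsilon>) (n_pub d \<alpha> \<beta>)
              (A_SSPP H rep \<epsilon> (n_priv d \<alpha> \<beta> \<epsilon>) (n_pub d \<alpha> \<beta>))) \<and>
     (\<forall>\<alpha>\<^sub>0. 0 < \<alpha>\<^sub>0 \<and> \<alpha>\<^sub>0 < 1 \<longrightarrow>
        (\<lambda>(d, \<alpha>, \<beta>, \<epsilon>). real (n_priv d \<alpha> \<beta> \<epsilon>)) \<in> O[parameters_below \<alpha>\<^sub>0](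
          \<lambda>(d, \<alpha>, \<beta>, \<epsilon>). (real d * ln (1 / \<alpha>) + ln (1 / \<beta>)) * max (1 / \<alpha>\<^sup>2) (1 / (\<epsilon> * \<alpha>))) \<and>
        (\<lambda>(d, \<alpha>, \<beta>, \<epsilon>). real (n_pub d \<alpha> \<beta>)) \<in> O[parameters_below \<alpha>\<^sub>0](
          \<lambda>(d, \<alpha>, \<beta>, \<epsilon>). (real d * ln (1 / \<alpha>) + ln (1 / \<beta>)) / \<alpha>))"
proof (intro exI[of _ n_priv] exI[of _ n_pub] conjI allI impI; (elim conjE)?)
  show "semi_private_learner M H \<alpha> \<beta> \<epsilon> (n_priv d \<alpha> \<beta> \<epsilon>) (n_pub d \<alpha> \<beta>)
      (A_SSPP H rep \<epsilon> (n_priv d \<alpha> \<beta> \<epsilon>) (n_pub d \<alpha> \<beta>))"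
    if "measurable_hypothesis_class M H" "H \<noteq> {}" "VC (space M) H = enat d"
      "0 < \<alpha>" "\<alpha> < 1" "0 < \<beta>" "\<beta> < 1" "0 < \<epsilon>" "representative_rule (space M) H (n_pub d \<alpha> \<beta>) rep"
    for M :: "'x measure" and H d \<alpha> \<beta> \<epsilon> rep
    using that by (rule A_SSPP_semi_private_learner)
next
  fix \<alpha>0 :: real assume \<alpha>0: "0 < \<alpha>0" "\<alpha>0 < 1"
  define c where "c = 1 + 2 * ln 128 / ln (1 / \<alpha>0)"
  have "c \<ge> 0" using \<alpha>0 by (simp add: c_def)
  then have norm_mono: "k * c * x \<le> k * c * norm x" if "k \<ge> 0" for k x :: real
    using that by (intro mult_left_mono) auto
  show "(\<lambda>(d, \<alpha>, \<beta>, \<epsilon>). real (n_priv d \<alpha> \<beta> \<epsilon>)) \<in> O[parameters_below \<alpha>0](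
      \<lambda>(d, \<alpha>, \<beta>, \<epsilon>). (real d * ln (1 / \<alpha>) + ln (1 / \<beta>)) * max (1 / \<alpha>\<^sup>2) (1 / (\<epsilon> * \<alpha>)))"
    unfolding parameters_below_def
  \<comment> \<open>The filter is principal, so the bound has to hold at every admissible parameter
    with the same constant; \<open>c\<close> depends on \<open>\<alpha>0\<close> alone.\<close>
  proof (rule bigoI[of _ "8192 * c"], unfold eventually_principal, rule ballI)
    fix x :: "nat \<times> real \<times> real \<times> real"
    obtain d \<alpha> \<beta> \<epsilon> where x: "x = (d, \<alpha>, \<beta>, \<epsilon>)" by (cases x)
    assume "x \<in> {(d, \<alpha>, \<beta>, \<epsilon>). 0 < \<alpha> \<and> \<alpha> \<le> \<alpha>0 \<and> 0 < \<beta> \<and> \<beta> < 1 \<and> 0 < \<epsilon>}"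
    then show "norm (case x of (d, \<alpha>, \<beta>, \<epsilon>) \<Rightarrow> real (n_priv d \<alpha> \<beta> \<epsilon>))
      \<le> 8192 * c * norm (case x of (d, \<alpha>, \<beta>, \<epsilon>) \<Rightarrow> (real d * ln (1 / \<alpha>) + ln (1 / \<beta>)) * max (1 / \<alpha>\<^sup>2) (1 / (\<epsilon> * \<alpha>)))"
      unfolding x prod.case norm_of_nat c_def mem_Collect_eq
      by (elim conjE) (rule order_trans[OF n_priv_le[OF \<alpha>0] norm_mono[unfolded c_def]], simp_all)
  qed
  show "(\<lambda>(d, \<alpha>, \<beta>, \<epsilon>). real (n_pub d \<alpha> \<beta>)) \<in> O[parameters_below \<alpha>0](
      \<lambda>(d, \<alpha>, \<beta>, \<epsilon>). (real d * ln (1 / \<alpha>) + ln (1 / \<beta>)) / \<alpha>)"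
    unfolding parameters_below_def
  proof (rule bigoI[of _ "128 * c"], unfold eventually_principal, rule ballI)
    fix x :: "nat \<times> real \<times> real \<times> real"
    obtain d \<alpha> \<beta> \<epsilon> where x: "x = (d, \<alpha>, \<beta>, \<epsilon>)" by (cases x)
    assume "x \<in> {(d, \<alpha>, \<beta>, \<epsilon>). 0 < \<alpha> \<and> \<alpha> \<le> \<alpha>0 \<and> 0 < \<beta> \<and> \<beta> < 1 \<and> 0 < \<epsilon>}"
    then show "norm (case x of (d, \<alpha>, \<beta>, \<epsilon>) \<Rightarrow> real (n_pub d \<alpha> \<beta>))
      \<le> 128 * c * norm (case x of (d, \<alpha>, \<beta>, \<epsilon>) \<Rightarrow> (real d * ln (1 / \<alpha>) + ln (1 / \<beta>)) / \<alpha>)"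
      unfolding x prod.case norm_of_nat c_def mem_Collect_eq
      by (elim conjE) (rule order_trans[OF n_pub_le[OF \<alpha>0] norm_mono[unfolded c_def]], simp_all)
  qed
qed

end
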